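(* Let $\mathcal{X}$ be a separable topological space, let $k$ be a bounded, continuous kernel on $\mathcal{X}$, and let $P$ be a Borel probability measure on $\mathcal{X}$. Let $P_n=n^{-1}\sum_{i=1}^n\delta_{X_i}$ be the empirical measure of i.i.d. observations $X_1,\dots,X_n$ from $P$. Then, as $n\to\infty$, $$n^{1/2}\left(\Phi_kP_n-\Phi_kP\right)\xrightarrow{d}Z,$$ where $Z$ is a Gaussian random element in the reproducing kernel Hilbert space $\mathcal{H}_k$ with covariance operator $C\in L_1^+(\mathcal{H}_k)$ given by $$\langle Cf,g\rangle_k=\mathbb{E}_{X\sim P}[f(X)g(X)].$$
   Context: A kernel on a set $\mathcal{X}$ is a symmetric function $k\colon\mathcal{X}\times\mathcal{X}\to\mathbb{R}$ that is positive definite, i.e. $\sum_{i,j=1}^{n}a_ia_jk(x_i,x_j)\ge 0$ for all $n\in\mathbb{N}$, $a_i\in\mathbb{R}$, $x_i\in\mathcal{X}$. $\mathcal{H}_k$ denotes its reproducing kernel Hilbert space: the Hilbert space of functions $\mathcal{X}\to\mathbb{R}$ with inner product $\langle\cdot,\cdot\rangle_k$ such that $k(\cdot,x)\in\mathcal{H}_k$ and $\langle f,k(\cdot,x)\rangle_k=f(x)$ for all $f\in\mathcal{H}_k$, $x\in\mathcal{X}$. $L_1^+(\mathcal{H}_k)$ is the space of symmetric, positive, trace class operators from $\mathcal{H}_k$ to $\mathcal{H}_k$. For a bounded measurable kernel $k$ and a Borel probability measure $Q$ on $\mathcal{X}$, the kernel mean embedding is $\Phi_kQ=\int_{\mathcal{X}}k(\cdot,y)\,dQ(y)\in\mathcal{H}_k$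 (Bochner integral); in particular $\Phi_kP_n=n^{-1}\sum_{i=1}^nk(\cdot,X_i)$. The symbol $\xrightarrow{d}$ denotes convergence in distribution (of random elements of $\mathcal{H}_k$), and the formula for $C$ is for $f,g\in\mathcal{H}_k$.
   Formalization: The covariance is taken as ⟨Cf,g⟩ = E[f(X)g(X)] − E[f(X)]E[g(X)]; the printed formula without the subtracted term is false (e.g. one-point space, k = 1) and agrees with this one exactly when Φ_kP = 0. *)

theory Defs
  imports "HOL-Probability.Probability"
begin

definition is_kernel :: "('x \<Rightarrow> 'x \<Rightarrow> real) \<Rightarrow> bool" where
  "is_kernel k \<longleftrightarrow>
     (\<forall>x y. k x y = k y x) \<and>
     (\<forall>(n::nat) (a::nat \<Rightarrow> real) (x::nat \<Rightarrow> 'x). (\<Sum>i<n. \<Sum>j<n. a i * a j * k (x i) (x j)) \<ge> 0)"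

text \<open>The reproducing kernel Hilbert space depends on the term \<open>k\<close>, so it cannot be a type
  constructor applied to \<open>k\<close>. It is a Hilbert space \<open>'h\<close> whose elements are identified with real
  functions through the injective linear evaluation map \<open>val\<close>: \<open>val f x\<close> is the value of \<open>f\<close> at \<open>x\<close>.
  No countability assumption is made on \<open>'h\<close>.\<close>

definition is_rkhs :: "('x \<Rightarrow> 'x \<Rightarrow> real) \<Rightarrow> ('h::{real_inner,banach} \<Rightarrow> 'x \<Rightarrow> real) \<Rightarrow> bool" where
  "is_rkhs k val \<longleftrightarrow>
     (\<forall>x. linear (\<lambda>f. val f x)) \<and> inj val \<and>
     (\<forall>x. \<exists>K. val K = (\<lambda>y. k y x) \<and> (\<forall>f. inner f K = val f x))"

definition kernel_section ::
  "('x \<Rightarrow> 'x \<Rightarrow> real) \<Rightarrow> ('h \<Rightarrow> 'x \<Rightarrow> real) \<Rightarrow> 'x \<Rightarrow> 'h" where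
  "kernel_section k val x = inv val (\<lambda>y. k y x)"

lemma is_rkhs_section:
  fixes val :: "'h::{real_inner,banach} \<Rightarrow> 'x \<Rightarrow> real"
  assumes "is_rkhs k val"
  shows "val (kernel_section k val x) = (\<lambda>y. k y x)"
    and "inner f (kernel_section k val x) = val f x"
proof -
  obtain K where K: "val K = (\<lambda>y. k y x)" "\<And>f. inner f K = val f x"
    using assms unfolding is_rkhs_def by blast
  have "kernel_section k val x = K"
    unfolding kernel_section_def using assms K(1) by (intro inv_f_eq) (simp_all add: is_rkhs_def)
  with K show "val (kernel_section k val x) = (\<lambda>y. k y x)"
    and "inner f (kernel_section k val x) = val f x" by simp_all
qed

text \<open>The Bochner integral, verbatim as for \<^const>\<open>has_bochner_integral\<close> and
  \<^const>\<open>lebesgue_integral\<close>, but without their sort constraint \<open>second_countable_topology\<close>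
  on the codomain; the lemma below shows that the notions agree under that constraint.\<close>

definition has_bochner_int :: "'a measure \<Rightarrow> ('a \<Rightarrow> 'b::real_normed_vector) \<Rightarrow> 'b \<Rightarrow> bool" where
  "has_bochner_int M f x \<longleftrightarrow>
     f \<in> borel_measurable M \<and>
     (\<exists>s. (\<forall>i. Bochner_Integration.simple_bochner_integrable M (s i)) \<and>
          (\<lambda>i. \<integral>\<^sup>+y. norm (f y - s i y) \<partial>M) \<longlonglongrightarrow> 0 \<and>
          (\<lambda>i. Bochner_Integration.simple_bochner_integral M (s i)) \<longlonglongrightarrow> x)"

definition bochner_int :: "'a measure \<Rightarrow> ('a \<Rightarrow> 'b::real_normed_vector) \<Rightarrow> 'b" where
  "bochner_int M f = (if \<exists>x. has_bochner_int M f x then THE x. has_bochner_int M f x else 0)"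

lemma bochner_int_eq_lebesgue_integral:
  fixes f :: "'a \<Rightarrow> 'b::{real_normed_vector,second_countable_topology}"
  shows "bochner_int M f = integral\<^sup>L M f"
proof -
  have "has_bochner_int M f = has_bochner_integral M f"
    by (rule ext) (auto simp: has_bochner_int_def has_bochner_integral.simps)
  then show ?thesis
    by (simp add: bochner_int_def lebesgue_integral_def)
qed

definition mean_embedding ::
  "('x::topological_space \<Rightarrow> 'x \<Rightarrow> real) \<Rightarrow> ('h::{real_inner,banach} \<Rightarrow> 'x \<Rightarrow> real) \<Rightarrow> 'x measure \<Rightarrow> 'h" where
  "mean_embedding k val Q = bochner_int Q (kernel_section k val)"

definition empirical_measure :: "(nat \<Rightarrow> 'x::topological_space) \<Rightarrow> nat \<Rightarrow> 'x measure" where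
  "empirical_measure x n = distr (uniform_count_measure {..<n}) borel x"

lemma measure_empirical_measure:
  assumes "A \<in> sets borel"
  shows "measure (empirical_measure x n) A = (\<Sum>i<n. indicator A (x i)) / n"
proof -
  have "x -` A \<inter> {..<n} = {i\<in>{..<n}. x i \<in> A}" by auto
  then have "measure (empirical_measure x n) A = measure (uniform_count_measure {..<n}) {i\<in>{..<n}. x i \<in> A}"
    unfolding empirical_measure_def using assms
    by (subst measure_distr)
       (auto simp: space_uniform_count_measure measurable_def sets_uniform_count_measure)
  also have "\<dots> = card {i\<in>{..<n}. x i \<in> A} / n"
    by (subst measure_uniform_count_measure) auto
  also have "real (card {i\<in>{..<n}. x i \<in> A}) = (\<Sum>i<n. indicator A (x i))"
    by (simp add: indicator_def sum.If_cases Int_def)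
  finally show ?thesis .
qed

text \<open>Point masses count as (degenerate) Gaussian laws.\<close>

definition gaussian_law :: "real measure \<Rightarrow> bool" where
  "gaussian_law D \<longleftrightarrow>
     (\<exists>m s. s > 0 \<and> D = density lborel (normal_density m s)) \<or> (\<exists>m. D = return borel m)"

definition gaussian_element :: "'a measure \<Rightarrow> ('a \<Rightarrow> 'h::{real_inner,banach}) \<Rightarrow> bool" where
  "gaussian_element N Z \<longleftrightarrow>
     prob_space N \<and> Z \<in> borel_measurable N \<and>
     (\<forall>f. gaussian_law (distr N borel (\<lambda>\<omega>. inner (Z \<omega>) f)))"

definition has_mean_zero :: "'a measure \<Rightarrow> ('a \<Rightarrow> 'h::{real_inner,banach}) \<Rightarrow> bool" where
  "has_mean_zero N Z \<longleftrightarrow> has_bochner_int N Z 0"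

definition has_covariance_operator ::
  "'a measure \<Rightarrow> ('a \<Rightarrow> 'h::{real_inner,banach}) \<Rightarrow> ('h \<Rightarrow> 'h) \<Rightarrow> bool" where
  "has_covariance_operator N Z C \<longleftrightarrow>
     (\<forall>f g. has_bochner_integral N
        (\<lambda>\<omega>. (inner (Z \<omega>) f - (\<integral>\<omega>'. inner (Z \<omega>') f \<partial>N)) * (inner (Z \<omega>) g - (\<integral>\<omega>'. inner (Z \<omega>') g \<partial>N)))
        (inner (C f) g))"

definition orthonormal_basis :: "'h::{real_inner,banach} set \<Rightarrow> bool" where
  "orthonormal_basis B \<longleftrightarrow>
     pairwise orthogonal B \<and> (\<forall>e\<in>B. norm e = 1) \<and> closure (span B) = UNIV"

text \<open>The symmetric, positive, trace class operators. A positive operator is its own absolute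
  value, so being trace class means that its diagonal is summable along an orthonormal basis.\<close>

definition L1_plus :: "('h::{real_inner,banach} \<Rightarrow> 'h) set" where
  "L1_plus = {C. bounded_linear C \<and>
     (\<forall>f g. inner (C f) g = inner f (C g)) \<and>
     (\<forall>f. inner (C f) f \<ge> 0) \<and>
     (\<exists>B. orthonormal_basis B \<and> (\<lambda>e. inner (C e) e) summable_on B)}"

definition converges_in_distribution ::
  "'w measure \<Rightarrow> (nat \<Rightarrow> 'w \<Rightarrow> 'h::topological_space) \<Rightarrow> 'a measure \<Rightarrow> ('a \<Rightarrow> 'h) \<Rightarrow> bool" where
  "converges_in_distribution M Y N Z \<longleftrightarrow>
     (\<forall>n. Y n \<in> borel_measurable M) \<and> Z \<in> borel_measurable N \<and>
     (\<forall>\<phi>::'h \<Rightarrow> real. continuous_on UNIV \<phi> \<longrightarrow> bounded (range \<phi>) \<longrightarrow>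
        (\<lambda>n. \<integral>\<omega>. \<phi> (Y n \<omega>) \<partial>M) \<longlonglongrightarrow> (\<integral>\<omega>. \<phi> (Z \<omega>) \<partial>N))"

end

(*
  In a Hilbert space with a countable total orthogonal sequence e, the sequence sqrt n (Phi P_n - Phi P)
  is uniformly tight: by Parseval and Markov its tails are controlled by sum_{i >= m} <C e_i, e_i>, which
  does not depend on n. On a compact set the finite sums of functions x |-> a cos(<x, t> + b) are uniformly
  dense (Stone-Weierstrass), so it suffices that E cos(<Y_n, t> + b) converges, and that is the
  one-dimensional central limit theorem applied to t(X_1), t(X_2), ... . The limit is built by hand:
  Gram-Schmidt for the (possibly degenerate) covariance form writes Gaussian coordinates with the required
  covariance as finite combinations of independent standard normals, and the trace bound makes the
  series in the basis e converge almost surely. The RKHS has a countable basis because the kernel sections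
  over a countable dense set of points span a dense subspace.
*)
theory Submission
  imports Defs
begin

text \<open>The limit has the centred covariance, since <Y_n, f> has the variance of f(X) for n > 0.
  The uncentred form E[f(X) g(X)] would not do: for the constant kernel 1 the process vanishes
  identically, while E[f(X)^2] is positive for f = 1. The trace is finite because at every point x
  the squares e_i(x)^2 = <k(., x), e_i>^2 sum to at most k(x, x), by Bessel. Two difficulties shape
  the development. Separability of \<open>'h\<close> is a consequence of the basis and not a
  property of its type, so Borel measurability, norms and Bochner integrals are all reduced to the
  real coordinates <., e_i>. Degeneracy cannot be excluded: the space may be finite dimensional, and
  the covariance may vanish on nonzero vectors. Hence one Gram-Schmidt process for semidefinite
  forms, with zeros in place of null vectors, serves twice: with the inner product it builds the
  basis of the RKHS from kernel sections, and with the covariance form it builds the Gaussian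
  coordinates.\<close>

section \<open>Gram--Schmidt for positive semidefinite forms\<close>

locale psd_form =
  fixes b :: "'v::real_vector \<Rightarrow> 'v \<Rightarrow> real"
  assumes sym: "b x y = b y x"
    and add_left: "b (x + y) z = b x z + b y z"
    and scale_left: "b (c *\<^sub>R x) y = c * b x y"
    and nonneg: "0 \<le> b x x"
begin

lemma linear_left: "linear (\<lambda>x. b x y)"
  by (rule linearI) (auto simp: add_left scale_left)

lemma linear_right: "linear (b x)"
  using linear_left[of x] by (simp add: sym[of _ x])

lemmas sum_left = linear_sum[OF linear_left] and sum_right = linear_sum[OF linear_right]
  and diff_left = linear_diff[OF linear_left] and diff_right = linear_diff[OF linear_right]
  and scale_right = linear_cmul[OF linear_right, simplified]
  and zero_left = linear_0[OF linear_left] and zero_right = linear_0[OF linear_right]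
  and add_right = linear_add[OF linear_right]

lemma Cauchy_Schwarz: "(b x y)\<^sup>2 \<le> b x x * b y y"
proof -
  have *: "0 \<le> b x x - 2 * t * b x y + t\<^sup>2 * b y y" for t
    using nonneg[of "x - t *\<^sub>R y"]
    by (simp add: diff_left diff_right scale_left scale_right sym[of y x] power2_eq_square algebra_simps)
  show ?thesis
  proof (cases "b y y = 0")
    case True
    have "b x y = 0"
    proof (rule ccontr)
      assume "b x y \<noteq> 0"
      \<comment> \<open>With \<open>b y y = 0\<close> the quadratic in t is affine, and this t gives
        it the value -1.\<close>
      with *[of "(b x x + 1) / (2 * b x y)"] True show False by simp
    qed
    with True show ?thesis by simp
  next
    case False
    then have "b y y > 0" using nonneg[of y] by simp
    \<comment> \<open>This t minimises the quadratic.\<close>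
    with *[of "b x y / b y y"] show ?thesis
      by (simp add: power2_eq_square field_simps)
  qed
qed

text \<open>Dropping a null vector from an expansion therefore changes no value of \<open>b\<close>,
  which is why Gram-Schmidt may discard it.\<close>

lemma null_left: "b x x = 0 \<Longrightarrow> b x y = 0"
  using Cauchy_Schwarz[of x y] by simp

lemma null_right: "b y y = 0 \<Longrightarrow> b x y = 0"
  using Cauchy_Schwarz[of x y] by simp

text \<open>A null vector is normalised to \<open>0\<close>, because \<open>1 / 0 = 0\<close>.\<close>

definition normalise :: "'v \<Rightarrow> 'v" where
  "normalise w = (1 / sqrt (b w w)) *\<^sub>R w"

lemma normalise_self: "b (normalise w) (normalise w) = (if b w w = 0 then 0 else 1)"
  using nonneg[of w] by (simp add: normalise_def scale_left scale_right)

fun gram_schmidt :: "(nat \<Rightarrow> 'v) \<Rightarrow> nat \<Rightarrow> 'v" where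
  "gram_schmidt d n = normalise (d n - (\<Sum>i<n. b (d n) (gram_schmidt d i) *\<^sub>R gram_schmidt d i))"

declare gram_schmidt.simps[simp del]

lemma gram_schmidt_self: "b (gram_schmidt d n) (gram_schmidt d n) \<in> {0, 1}"
  by (subst (1 2) gram_schmidt.simps) (simp add: normalise_self)

text \<open>Either the vector is normalised, or it is null and both sides vanish; this spares later
  proofs the case distinction.\<close>

lemma gram_schmidt_mult_self:
  "b x (gram_schmidt d n) * b (gram_schmidt d n) (gram_schmidt d n) = b x (gram_schmidt d n)"
  using gram_schmidt_self[of d n] null_right[of "gram_schmidt d n" x] by auto

text \<open>In the sum subtracted from \<open>d n\<close> the induction hypothesis kills every term
  except i = j, and that one cancels \<open>b (d n) (gram_schmidt d j)\<close>. Rescaling by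
  \<open>normalise\<close> keeps the result 0.\<close>

lemma gram_schmidt_orthogonal_less: "j < n \<Longrightarrow> b (gram_schmidt d n) (gram_schmidt d j) = 0"
proof (induction n arbitrary: j rule: less_induct)
  case (less n)
  let ?u = "gram_schmidt d"
  have "(\<Sum>i<n. b (d n) (?u i) * b (?u i) (?u j)) = (\<Sum>i<n. if i = j then b (d n) (?u j) else 0)"
  proof (rule sum.cong[OF refl])
    fix i assume "i \<in> {..<n}"
    then show "b (d n) (?u i) * b (?u i) (?u j) = (if i = j then b (d n) (?u j) else 0)"
    proof (cases i j rule: linorder_cases)
      case less
      with less.prems have "b (?u j) (?u i) = 0" by (intro less.IH) auto
      with less show ?thesis by (simp add: sym[of "?u i"])
    next
      case equal
      then show ?thesis by (simp add: gram_schmidt_mult_self)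
    next
      case greater
      with \<open>i \<in> {..<n}\<close> have "b (?u i) (?u j) = 0" by (intro less.IH) auto
      with greater show ?thesis by simp
    qed
  qed
  then have "b (d n - (\<Sum>i<n. b (d n) (?u i) *\<^sub>R ?u i)) (?u j) = 0"
    using less.prems by (simp add: diff_left sum_left scale_left)
  then show ?case
    by (subst gram_schmidt.simps) (simp add: normalise_def scale_left)
qed

lemma gram_schmidt_orthogonal: "i \<noteq> j \<Longrightarrow> b (gram_schmidt d i) (gram_schmidt d j) = 0"
  using gram_schmidt_orthogonal_less[of i j d] gram_schmidt_orthogonal_less[of j i d]
  by (metis linorder_neqE_nat sym)

text \<open>The n-th vector comes from w, the part of \<open>d n\<close> left over by the earlier
  ones. If w is null, it is the whole residual; otherwise subtracting the component along the n-th
  vector removes all of w.\<close>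

lemma gram_schmidt_residual:
  fixes d n
  defines "r \<equiv> d n - (\<Sum>i\<le>n. b (d n) (gram_schmidt d i) *\<^sub>R gram_schmidt d i)"
  shows "b r r = 0"
proof -
  let ?u = "gram_schmidt d"
  define w where "w = d n - (\<Sum>i<n. b (d n) (?u i) *\<^sub>R ?u i)"
  have u: "?u n = (1 / sqrt (b w w)) *\<^sub>R w"
    by (subst gram_schmidt.simps) (simp add: w_def normalise_def)
  have "b w (?u n) = b (d n) (?u n)"
    by (simp add: w_def diff_left sum_left scale_left gram_schmidt_orthogonal)
  then have r: "r = w - b w (?u n) *\<^sub>R ?u n"
    by (simp add: r_def w_def lessThan_Suc_atMost[symmetric])
  show ?thesis
  proof (cases "b w w = 0")
    case True
    with r u show ?thesis by simp
  next
    case False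
    then have "b w w > 0" using nonneg[of w] by simp
    then have "r = 0"
      unfolding r by (simp add: u scale_right)
    then show ?thesis by (simp add: zero_left)
  qed
qed

text \<open>Up to a null vector \<open>d n\<close> lies in the span of the vectors 0 to n, and the
  coefficients beyond n vanish, so any m above n will do. For y in the range of \<open>d\<close>
  this is the Cholesky factorisation of the Gram matrix of \<open>b\<close>.\<close>

lemma gram_schmidt_expand:
  assumes "n < m"
  shows "b (d n) y = (\<Sum>i<m. b (d n) (gram_schmidt d i) * b (gram_schmidt d i) y)"
proof -
  let ?u = "gram_schmidt d"
  have *: "b (d n) y = (\<Sum>i\<le>n. b (d n) (?u i) * b (?u i) y)" for y
    using null_left[OF gram_schmidt_residual, of d n y]
    by (simp add: diff_left sum_left scale_left)
  have "b (d n) (?u j) = 0" if "j > n" for j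
    using that by (subst *) (simp add: gram_schmidt_orthogonal)
  then have "(\<Sum>i<m. b (d n) (?u i) * b (?u i) y) = (\<Sum>i\<le>n. b (d n) (?u i) * b (?u i) y)"
    using assms by (intro sum.mono_neutral_right) auto
  with *[of y] show ?thesis by (rule trans[OF _ HOL.sym])
qed

text \<open>Parseval for a finite combination. The right-hand side will be the variance of a sum of
  independent normals with these coefficients.\<close>

lemma gram_schmidt_span_expand:
  fixes a d m
  defines "x \<equiv> (\<Sum>n<m. a n *\<^sub>R d n)"
  shows "b x x = (\<Sum>i<m. (b x (gram_schmidt d i))\<^sup>2)"
proof -
  let ?u = "gram_schmidt d"
  have "b x x = (\<Sum>n<m. a n * b (d n) x)"
    by (subst x_def) (simp add: sum_left scale_left)
  also have "\<dots> = (\<Sum>n<m. a n * (\<Sum>i<m. b (d n) (?u i) * b (?u i) x))"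
    by (intro sum.cong refl) (simp add: gram_schmidt_expand[symmetric])
  also have "\<dots> = (\<Sum>i<m. (\<Sum>n<m. a n * b (d n) (?u i)) * b (?u i) x)"
    by (simp add: sum_distrib_left sum_distrib_right mult.assoc) (rule sum.swap)
  also have "\<dots> = (\<Sum>i<m. (b x (?u i))\<^sup>2)"
    unfolding x_def by (simp add: sum_left scale_left power2_eq_square sum_right scale_right sym[of "?u _" "d _"])
  finally show ?thesis .
qed

end

interpretation inner_form: psd_form "inner :: 'h::real_inner \<Rightarrow> 'h \<Rightarrow> real"
  by unfold_locales (rule inner_commute, simp_all add: inner_add_left)

section \<open>Hilbert spaces with a countable total orthogonal sequence\<close>

text \<open>The sequence enumerates an orthonormal basis, padded with zeros, so that finite and infinite
  dimension are treated alike.\<close>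

locale hilbert_basis =
  fixes e :: "nat \<Rightarrow> 'h::{real_inner,banach}"
  assumes orth: "i \<noteq> j \<Longrightarrow> inner (e i) (e j) = 0"
    and unit: "inner (e i) (e i) \<in> {0, 1}"
    and total: "(\<And>i. inner f (e i) = 0) \<Longrightarrow> f = 0"
begin

definition proj :: "nat \<Rightarrow> 'h \<Rightarrow> 'h" where
  "proj m x = (\<Sum>i<m. inner x (e i) *\<^sub>R e i)"

lemma coeff_mult_self: "inner x (e i) * inner (e i) (e i) = inner x (e i)"
  using unit[of i] by auto

lemma coeff_eqI: "(\<And>i. inner x (e i) = inner y (e i)) \<Longrightarrow> x = y"
  using total[of "x - y"] by (simp add: inner_diff_left)

lemma inner_sum_basis:
  assumes "finite A"
  shows "inner (\<Sum>i\<in>A. a i *\<^sub>R e i) (e j) = (if j \<in> A then a j * inner (e j) (e j) else 0)"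
proof -
  have "inner (\<Sum>i\<in>A. a i *\<^sub>R e i) (e j) = (\<Sum>i\<in>A. if i = j then a j * inner (e j) (e j) else 0)"
    by (auto simp: inner_sum_left orth intro!: sum.cong)
  with assms show ?thesis by simp
qed

lemma norm_sum_basis:
  assumes "finite A"
  shows "(norm (\<Sum>i\<in>A. a i *\<^sub>R e i))\<^sup>2 = (\<Sum>i\<in>A. (a i)\<^sup>2 * inner (e i) (e i))"
  unfolding power2_norm_eq_inner using assms
  by (subst inner_sum_right) (simp add: inner_sum_basis power2_eq_square mult_ac)

lemma norm_sum_basis_le:
  assumes "finite A"
  shows "(norm (\<Sum>i\<in>A. a i *\<^sub>R e i))\<^sup>2 \<le> (\<Sum>i\<in>A. (a i)\<^sup>2)"
proof -
  have "(a i)\<^sup>2 * inner (e i) (e i) \<le> (a i)\<^sup>2" for i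
    using unit[of i] by auto
  with assms show ?thesis by (simp add: norm_sum_basis sum_mono)
qed

text \<open>Pythagoras carries the Cauchy criterion over from the squares to the vectors;
  completeness of \<open>'h\<close> enters here.\<close>

lemma summable_basis:
  assumes "summable (\<lambda>i. (a i)\<^sup>2)"
  shows "summable (\<lambda>i. a i *\<^sub>R e i)"
  unfolding summable_Cauchy
proof (intro allI impI)
  fix \<epsilon> :: real assume "\<epsilon> > 0"
  then have "\<epsilon>\<^sup>2 > 0" by simp
  with assms obtain K where K: "\<And>m n. m \<ge> K \<Longrightarrow> norm (\<Sum>i=m..<n. (a i)\<^sup>2) < \<epsilon>\<^sup>2"
    unfolding summable_Cauchy by blast
  have "norm (\<Sum>i=m..<n. a i *\<^sub>R e i) < \<epsilon>" if "m \<ge> K" for m n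
  proof -
    have "(norm (\<Sum>i=m..<n. a i *\<^sub>R e i))\<^sup>2 < \<epsilon>\<^sup>2"
      using norm_sum_basis_le[of "{m..<n}" a] K[OF that, of n] by simp
    then show ?thesis
      using \<open>\<epsilon> > 0\<close> by (simp add: power2_less_imp_less)
  qed
  then show "\<exists>N. \<forall>m\<ge>N. \<forall>n. norm (\<Sum>i=m..<n. a i *\<^sub>R e i) < \<epsilon>" by blast
qed

lemma proj_residual: "(norm (x - proj m x))\<^sup>2 = (norm x)\<^sup>2 - (\<Sum>i<m. (inner x (e i))\<^sup>2)"
proof -
  have "inner x (proj m x) = (\<Sum>i<m. (inner x (e i))\<^sup>2)"
    by (simp add: proj_def inner_sum_right power2_eq_square)
  moreover have "(norm (proj m x))\<^sup>2 = (\<Sum>i<m. (inner x (e i))\<^sup>2)"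
    unfolding proj_def by (simp add: norm_sum_basis) (simp add: power2_eq_square mult.assoc coeff_mult_self)
  ultimately show ?thesis
    by (simp add: power2_norm_eq_inner inner_diff_left inner_diff_right inner_commute[of "proj m x" x])
qed

lemma Bessel: "(\<Sum>i<m. (inner x (e i))\<^sup>2) \<le> (norm x)\<^sup>2"
  using proj_residual[of x m] by (smt (verit) zero_le_power2)

lemma summable_coeff: "summable (\<lambda>i. (inner x (e i))\<^sup>2)"
  by (rule summableI_nonneg_bounded[where x="(norm x)\<^sup>2"]) (auto simp: Bessel)

lemma inner_suminf_basis:
  assumes "summable (\<lambda>i. a i *\<^sub>R e i)"
  shows "inner (\<Sum>i. a i *\<^sub>R e i) (e j) = a j * inner (e j) (e j)"
proof (rule LIMSEQ_unique)
  have "(\<lambda>n. \<Sum>i<n. a i *\<^sub>R e i) \<longlonglongrightarrow> (\<Sum>i. a i *\<^sub>R e i)"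
    using assms by (rule summable_LIMSEQ)
  then show "(\<lambda>n. inner (\<Sum>i<n. a i *\<^sub>R e i) (e j)) \<longlonglongrightarrow> inner (\<Sum>i. a i *\<^sub>R e i) (e j)"
    by (intro tendsto_intros)
  have "\<forall>\<^sub>F n in sequentially. inner (\<Sum>i<n. a i *\<^sub>R e i) (e j) = a j * inner (e j) (e j)"
    using eventually_gt_at_top[of j] by eventually_elim (simp add: inner_sum_basis)
  then show "(\<lambda>n. inner (\<Sum>i<n. a i *\<^sub>R e i) (e j)) \<longlonglongrightarrow> a j * inner (e j) (e j)"
    by (rule tendsto_eventually)
qed

text \<open>The series converges by Bessel, and its sum has the same coefficients as x, so totality
  identifies the two.\<close>

lemma proj_tendsto: "(\<lambda>m. proj m x) \<longlonglongrightarrow> x"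
proof -
  have s: "summable (\<lambda>i. inner x (e i) *\<^sub>R e i)"
    by (intro summable_basis summable_coeff)
  have "(\<Sum>i. inner x (e i) *\<^sub>R e i) = x"
    by (rule coeff_eqI) (simp add: inner_suminf_basis[OF s] coeff_mult_self)
  with summable_LIMSEQ[OF s] show ?thesis by (simp add: proj_def)
qed

lemma Parseval: "(\<lambda>i. (inner x (e i))\<^sup>2) sums (norm x)\<^sup>2"
proof -
  have "(\<lambda>m. (norm x)\<^sup>2 - (norm (x - proj m x))\<^sup>2) \<longlonglongrightarrow> (norm x)\<^sup>2 - (norm (x - x))\<^sup>2"
    by (intro tendsto_intros proj_tendsto)
  then show ?thesis
    by (simp add: sums_def proj_residual)
qed

lemma proj_residual_sums: "(\<lambda>i. (inner x (e (i + m)))\<^sup>2) sums (norm (x - proj m x))\<^sup>2"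
  using sums_split_initial_segment[OF Parseval, of x m] by (simp add: proj_residual)

lemma continuous_proj [continuous_intros]: "continuous_on S (proj m)"
  unfolding proj_def by (intro continuous_intros)

text \<open>Rational combinations of the \<open>e i\<close> are encoded by lists of rationals, which
  form a countable type.\<close>

lemma exists_dense_sequence:
  obtains d :: "nat \<Rightarrow> 'h" where "\<And>x \<epsilon>. \<epsilon> > 0 \<Longrightarrow> \<exists>n. norm (x - d n) < \<epsilon>"
proof -
  define h where "h l = (\<Sum>i<length l. real_of_rat (l ! i) *\<^sub>R e i)" for l
  define d where "d n = h (from_nat n)" for n
  have "\<exists>n. norm (x - d n) < \<epsilon>" if "\<epsilon> > 0" for x \<epsilon>
  proof -
    have "\<forall>\<^sub>F m in sequentially. dist (proj m x) x < \<epsilon> / 2"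
      using tendstoD[OF proj_tendsto, of "\<epsilon> / 2" x] that by simp
    then obtain m where m: "dist (proj m x) x < \<epsilon> / 2"
      by (auto simp: eventually_sequentially)
    \<comment> \<open>At most m errors below this size add up to at most half of the tolerance; the
      1 avoids division by zero when m = 0.\<close>
    define \<delta> where "\<delta> = \<epsilon> / (2 * (real m + 1))"
    have "\<delta> > 0" using that by (simp add: \<delta>_def)
    have "\<exists>q. \<bar>real_of_rat q - inner x (e i)\<bar> < \<delta>" for i
    proof -
      obtain q where "inner x (e i) < real_of_rat q" "real_of_rat q < inner x (e i) + \<delta>"
        using of_rat_dense[of "inner x (e i)" "inner x (e i) + \<delta>"] \<open>\<delta> > 0\<close> by auto
      then show ?thesis by (intro exI[of _ q]) auto
    qed
    then obtain q where q: "\<And>i. \<bar>real_of_rat (q i) - inner x (e i)\<bar> < \<delta>" by metis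
    define l where "l = map q [0..<m]"
    have "norm (e i) \<le> 1" for i
      using unit[of i] by (auto simp: norm_eq_sqrt_inner)
    then have "norm ((real_of_rat (q i) - inner x (e i)) *\<^sub>R e i) \<le> \<delta>" for i
      using q[of i] mult_mono[of "\<bar>real_of_rat (q i) - inner x (e i)\<bar>" \<delta> "norm (e i)" 1] by simp
    then have "norm (\<Sum>i<m. (real_of_rat (q i) - inner x (e i)) *\<^sub>R e i) \<le> (\<Sum>i<m. \<delta>)"
      by (intro sum_norm_le) auto
    moreover have "(\<Sum>i<m. \<delta>) \<le> \<epsilon> / 2"
      using that by (simp add: \<delta>_def field_simps)
    moreover have "h l - proj m x = (\<Sum>i<m. (real_of_rat (q i) - inner x (e i)) *\<^sub>R e i)"
      by (simp add: h_def l_def proj_def scaleR_diff_left sum_subtractf)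
    ultimately have "norm (x - h l) < \<epsilon>"
      using m norm_triangle_ineq4[of "proj m x - x" "proj m x - h l"]
      by (simp add: dist_norm norm_minus_commute)
    then show ?thesis
      by (intro exI[of _ "to_nat l"]) (simp add: d_def)
  qed
  with that[of d] show thesis by blast
qed

end

section \<open>Borel measurability and the Bochner integral\<close>

lemma borel_measurable_inner_right:
  fixes f :: "'a \<Rightarrow> 'h::real_inner"
  assumes "f \<in> borel_measurable M"
  shows "(\<lambda>\<omega>. inner (f \<omega>) g) \<in> borel_measurable M"
  by (rule measurable_compose[OF assms]) (intro borel_measurable_continuous_onI continuous_intros)

text \<open>It makes the integrals of an approximating sequence of simple functions a Cauchy
  sequence.\<close>

lemma norm_simple_bochner_integral_diff_le:
  assumes s: "Bochner_Integration.simple_bochner_integrable M s"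
    and t: "Bochner_Integration.simple_bochner_integrable M t"
  shows "ennreal (norm (Bochner_Integration.simple_bochner_integral M s - Bochner_Integration.simple_bochner_integral M t))
    \<le> (\<integral>\<^sup>+ x. norm (s x - t x) \<partial>M)"
proof -
  have "ennreal (norm (Bochner_Integration.simple_bochner_integral M s - Bochner_Integration.simple_bochner_integral M t))
      = norm (Bochner_Integration.simple_bochner_integral M (\<lambda>x. s x - t x))"
    using s t by (subst simple_bochner_integral_diff) auto
  also have "\<dots> \<le> Bochner_Integration.simple_bochner_integral M (\<lambda>x. norm (s x - t x))"
    using simple_bochner_integrable_compose2[of "(-)" M "s" "t"] s t
    by (auto intro!: simple_bochner_integral_norm_bound)
  also have "\<dots> = (\<integral>\<^sup>+x. norm (s x - t x) \<partial>M)"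
    using simple_bochner_integrable_compose2[of "\<lambda>x y. norm (x - y)" M "s" "t"] s t
    by (auto intro!: simple_bochner_integral_eq_nn_integral)
  finally show ?thesis .
qed

context hilbert_basis
begin

lemma norm_eq_suminf: "norm x = sqrt (\<Sum>i. (inner x (e i))\<^sup>2)"
  using sums_unique[OF Parseval[of x]] by (metis norm_ge_zero real_sqrt_unique)

text \<open>By Parseval the norm is a countable expression in the coordinates. The hypothesis is on
  coordinates only, so a difference of two maps can be treated without knowing that the difference
  itself is Borel.\<close>

lemma norm_measurable:
  assumes [measurable]: "\<And>i. (\<lambda>\<omega>. inner (f \<omega>) (e i)) \<in> borel_measurable M"
  shows "(\<lambda>\<omega>. norm (f \<omega>)) \<in> borel_measurable M"
  unfolding norm_eq_suminf by measurable

lemma norm_diff_measurable: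
  assumes [measurable]: "\<And>i. (\<lambda>\<omega>. inner (f \<omega>) (e i)) \<in> borel_measurable M"
    and [measurable]: "\<And>i. (\<lambda>\<omega>. inner (g \<omega>) (e i)) \<in> borel_measurable M"
  shows "(\<lambda>\<omega>. norm (f \<omega> - g \<omega>)) \<in> borel_measurable M"
  by (rule norm_measurable) (simp add: inner_diff_left)

lemma borel_measurable_norm_diff:
  fixes f g :: "'a \<Rightarrow> 'h"
  assumes "f \<in> borel_measurable M" "g \<in> borel_measurable M"
  shows "(\<lambda>\<omega>. norm (f \<omega> - g \<omega>)) \<in> borel_measurable M"
  using assms by (intro norm_diff_measurable borel_measurable_inner_right)

text \<open>An open set is a countable union of balls with centres in a dense sequence and radii 1 /
  (m + 1), and the distance to a fixed centre is measurable.\<close>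

lemma borel_measurable_coeffI:
  assumes "\<And>i. (\<lambda>\<omega>. inner (f \<omega>) (e i)) \<in> borel_measurable M"
  shows "f \<in> borel_measurable M"
proof (rule borel_measurableI)
  fix U :: "'h set" assume "open U"
  obtain d :: "nat \<Rightarrow> 'h" where d: "\<And>x \<epsilon>. \<epsilon> > 0 \<Longrightarrow> \<exists>n. norm (x - d n) < \<epsilon>"
    using exists_dense_sequence by blast
  define I where "I = {(n, m). ball (d n) (1 / Suc m) \<subseteq> U}"
  have [measurable]: "(\<lambda>\<omega>. norm (f \<omega> - c)) \<in> borel_measurable M" for c
    using assms by (rule norm_diff_measurable) simp
  have "\<exists>n m. (n, m) \<in> I \<and> norm (x - d n) < 1 / Suc m" if "x \<in> U" for x
  proof -
    obtain r where r: "r > 0" "ball x r \<subseteq> U"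
      using \<open>open U\<close> \<open>x \<in> U\<close> open_contains_ball by blast
    \<comment> \<open>Two points of a ball of radius 1 / (m + 1) are then less than r apart.\<close>
    obtain m where m: "1 / real (Suc m) < r / 2"
      using reals_Archimedean[of "r / 2"] r(1) by (auto simp: inverse_eq_divide)
    obtain n where n: "norm (x - d n) < 1 / Suc m"
      using d[of "1 / Suc m" x] by auto
    have "ball (d n) (1 / Suc m) \<subseteq> ball x r"
    proof
      fix y assume "y \<in> ball (d n) (1 / Suc m)"
      then have "dist x y < r"
        using n m dist_triangle[of x y "d n"] by (simp add: dist_norm)
      then show "y \<in> ball x r" by simp
    qed
    with r n show ?thesis unfolding I_def by blast
  qed
  then have "f -` U \<inter> space M = (\<Union>(n, m)\<in>I. {\<omega>\<in>space M. norm (f \<omega> - d n) < 1 / Suc m})"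
    by (fastforce simp: I_def dist_norm norm_minus_commute)
  also have "\<dots> \<in> sets M"
    by (rule sets.countable_UN'') auto
  finally show "f -` U \<inter> space M \<in> sets M" .
qed

text \<open>Pairing the approximating simple functions with g multiplies their error by at most
  \<open>norm g\<close>. Through this, vector integrals are determined by real ones.\<close>

lemma has_bochner_int_inner:
  fixes f :: "'a \<Rightarrow> 'h"
  assumes "has_bochner_int M f x"
  shows "has_bochner_integral M (\<lambda>\<omega>. inner (f \<omega>) g) (inner x g)"
proof -
  obtain s where f: "f \<in> borel_measurable M"
    and s: "\<And>i. Bochner_Integration.simple_bochner_integrable M (s i)"
    and lim: "(\<lambda>i. \<integral>\<^sup>+y. norm (f y - s i y) \<partial>M) \<longlonglongrightarrow> 0"
    and x: "(\<lambda>i. Bochner_Integration.simple_bochner_integral M (s i)) \<longlonglongrightarrow> x"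
    using assms unfolding has_bochner_int_def by blast
  have sm: "s i \<in> borel_measurable M" for i
    using s[of i] by (auto simp: simple_bochner_integrable.simps intro: borel_measurable_simple_function)
  have lin: "linear (\<lambda>x. inner x g)"
    by (rule linearI) (auto simp: inner_add_left)
  show ?thesis
  proof (rule has_bochner_integral.intros)
    show "(\<lambda>\<omega>. inner (f \<omega>) g) \<in> borel_measurable M"
      using f by (rule borel_measurable_inner_right)
    show "Bochner_Integration.simple_bochner_integrable M (\<lambda>\<omega>. inner (s i \<omega>) g)" for i
      using simple_bochner_integrable_compose2[of "\<lambda>x y. inner x g", OF _ s[of i] s[of i]] by simp
    show "(\<lambda>i. Bochner_Integration.simple_bochner_integral M (\<lambda>\<omega>. inner (s i \<omega>) g)) \<longlonglongrightarrow> inner x g"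
      using simple_bochner_integral_linear[OF lin s] tendsto_inner[OF x tendsto_const[of g]] by simp
    have le: "(\<integral>\<^sup>+y. norm (inner (f y) g - inner (s i y) g) \<partial>M) \<le> norm g * (\<integral>\<^sup>+y. norm (f y - s i y) \<partial>M)" for i
    proof -
      have "(\<integral>\<^sup>+y. norm (inner (f y) g - inner (s i y) g) \<partial>M) \<le> (\<integral>\<^sup>+y. norm g * norm (f y - s i y) \<partial>M)"
        by (intro nn_integral_mono ennreal_leI)
           (metis Cauchy_Schwarz_ineq2 inner_diff_left mult.commute real_norm_def)
      also have "\<dots> = norm g * (\<integral>\<^sup>+y. norm (f y - s i y) \<partial>M)"
        using borel_measurable_norm_diff[OF f sm]
        by (subst nn_integral_cmult[symmetric]) (auto simp: ennreal_mult)
      finally show ?thesis .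
    qed
    have "(\<lambda>i. norm g * (\<integral>\<^sup>+y. norm (f y - s i y) \<partial>M)) \<longlonglongrightarrow> ennreal (norm g) * 0"
      using lim by (intro ennreal_tendsto_cmult) auto
    then have "(\<lambda>i. norm g * (\<integral>\<^sup>+y. norm (f y - s i y) \<partial>M)) \<longlonglongrightarrow> 0"
      by simp
    with tendsto_const show "(\<lambda>i. \<integral>\<^sup>+y. norm (inner (f y) g - inner (s i y) g) \<partial>M) \<longlonglongrightarrow> 0"
      by (rule tendsto_sandwich[rotated 2]) (auto simp: le[simplified])
  qed
qed

text \<open>Needed to evaluate the definite description in \<open>bochner_int\<close>.\<close>

lemma has_bochner_int_unique:
  fixes f :: "'a \<Rightarrow> 'h"
  assumes "has_bochner_int M f x" "has_bochner_int M f y"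
  shows "x = y"
  using assms[THEN has_bochner_int_inner] by (intro coeff_eqI) (blast intro: has_bochner_integral_eq)

text \<open>A dense sequence supplies simple functions that converge pointwise to f. Dominated
  convergence makes the error integrals vanish, and completeness of \<open>'h\<close> gives the
  limit of the integrals.\<close>

lemma has_bochner_int_exists:
  fixes f :: "'a \<Rightarrow> 'h"
  assumes "finite_measure M" and f: "f \<in> borel_measurable M"
    and int: "(\<integral>\<^sup>+\<omega>. norm (f \<omega>) \<partial>M) < \<infinity>"
  shows "\<exists>x. has_bochner_int M f x"
proof -
  interpret finite_measure M by fact
  obtain d :: "nat \<Rightarrow> 'h" where d: "\<And>x \<epsilon>. \<epsilon> > 0 \<Longrightarrow> \<exists>n. norm (x - d n) < \<epsilon>"
    using exists_dense_sequence by blast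
  text \<open>\<open>s m \<omega>\<close> is a nearest point to \<open>f \<omega>\<close> among \<open>0, d 0, \<dots>, d (m - 1)\<close>.\<close>
  define s where "s = rec_nat (\<lambda>\<omega>. 0)
    (\<lambda>m s \<omega>. if norm (f \<omega> - d m) < norm (f \<omega> - s \<omega>) then d m else s \<omega>)"
  have s0: "s 0 = (\<lambda>\<omega>. 0)" by (simp add: s_def)
  have sS: "s (Suc m) = (\<lambda>\<omega>. if norm (f \<omega> - d m) < norm (f \<omega> - s m \<omega>) then d m else s m \<omega>)" for m
    unfolding s_def by simp
  have sf: "simple_function M (s m)" for m
  proof (induction m)
    case (Suc m)
    have [measurable]: "(\<lambda>\<omega>. norm (f \<omega> - s m \<omega>)) \<in> borel_measurable M"
        "(\<lambda>\<omega>. norm (f \<omega> - d m)) \<in> borel_measurable M"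
      using f borel_measurable_simple_function[OF Suc] by (auto intro: borel_measurable_norm_diff)
    show ?case
      unfolding sS by (intro simple_function_If Suc simple_function_const) measurable
  qed (simp add: s0)
  have nm [measurable]: "(\<lambda>\<omega>. norm (f \<omega> - s m \<omega>)) \<in> borel_measurable M" for m
    using f borel_measurable_simple_function[OF sf] by (rule borel_measurable_norm_diff)
  have fm [measurable]: "(\<lambda>\<omega>. norm (f \<omega>)) \<in> borel_measurable M"
    using nm[of 0] by (simp add: s0)
  have sbi: "Bochner_Integration.simple_bochner_integrable M (s m)" for m
    by (rule simple_bochner_integrable.intros[OF sf]) (simp add: less_top[symmetric])
  have anti: "norm (f \<omega> - s n \<omega>) \<le> norm (f \<omega> - s m \<omega>)" if "m \<le> n" for m n \<omega>
    using that by (induction n rule: dec_induct) (auto simp: sS)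
  \<comment> \<open>Since 0 is the first candidate, the integrable function
    \<open>norm (f \<omega>)\<close> dominates every error.\<close>
  have lef: "norm (f \<omega> - s m \<omega>) \<le> norm (f \<omega>)" for m \<omega>
    using anti[of 0 m \<omega>] by (simp add: s0)
  have led: "norm (f \<omega> - s m \<omega>) \<le> norm (f \<omega> - d n)" if "n < m" for m n \<omega>
    using anti[of "Suc n" m \<omega>] that by (auto simp: sS split: if_splits)
  have ptw: "(\<lambda>m. norm (f \<omega> - s m \<omega>)) \<longlonglongrightarrow> 0" for \<omega>
  proof (rule LIMSEQ_I)
    fix \<epsilon> :: real assume "\<epsilon> > 0"
    then obtain n where "norm (f \<omega> - d n) < \<epsilon>" using d by blast
    then show "\<exists>m0. \<forall>m\<ge>m0. norm (norm (f \<omega> - s m \<omega>) - 0) < \<epsilon>"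
      using le_less_trans[OF led[of n]] by (intro exI[of _ "Suc n"]) auto
  qed
  have lim: "(\<lambda>m. \<integral>\<^sup>+\<omega>. norm (f \<omega> - s m \<omega>) \<partial>M) \<longlonglongrightarrow> 0"
  proof -
    have "(\<lambda>m. \<integral>\<^sup>+\<omega>. ennreal (norm (f \<omega> - s m \<omega>)) \<partial>M) \<longlonglongrightarrow> (\<integral>\<^sup>+\<omega>. ennreal 0 \<partial>M)"
      by (rule nn_integral_dominated_convergence[where w="\<lambda>\<omega>. ennreal (norm (f \<omega>))"])
         (use int lef tendsto_ennrealI[OF ptw] in \<open>simp_all add: ennreal_leI\<close>)
    then show ?thesis by simp
  qed
  let ?I = "\<lambda>m. Bochner_Integration.simple_bochner_integral M (s m)"
  have dist_I: "ennreal (norm (?I m - ?I n))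
      \<le> (\<integral>\<^sup>+\<omega>. norm (f \<omega> - s m \<omega>) \<partial>M) + (\<integral>\<^sup>+\<omega>. norm (f \<omega> - s n \<omega>) \<partial>M)" for m n
  proof -
    have "ennreal (norm (?I m - ?I n)) \<le> (\<integral>\<^sup>+\<omega>. norm (s m \<omega> - s n \<omega>) \<partial>M)"
      by (intro norm_simple_bochner_integral_diff_le sbi)
    also have "\<dots> \<le> (\<integral>\<^sup>+\<omega>. ennreal (norm (f \<omega> - s m \<omega>)) + ennreal (norm (f \<omega> - s n \<omega>)) \<partial>M)"
    proof (intro nn_integral_mono)
      fix \<omega>
      have "norm (s m \<omega> - s n \<omega>) \<le> norm (f \<omega> - s m \<omega>) + norm (f \<omega> - s n \<omega>)"
        by (metis dual_order.refl norm_diff_triangle_le norm_minus_commute)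
      then show "ennreal (norm (s m \<omega> - s n \<omega>)) \<le> ennreal (norm (f \<omega> - s m \<omega>)) + ennreal (norm (f \<omega> - s n \<omega>))"
        by (metis ennreal_leI ennreal_plus norm_ge_zero)
    qed
    also have "\<dots> = (\<integral>\<^sup>+\<omega>. norm (f \<omega> - s m \<omega>) \<partial>M) + (\<integral>\<^sup>+\<omega>. norm (f \<omega> - s n \<omega>) \<partial>M)"
      by (rule nn_integral_add) auto
    finally show ?thesis .
  qed
  have "Cauchy ?I"
  proof (rule CauchyI)
    fix \<epsilon> :: real assume "\<epsilon> > 0"
    then have "\<forall>\<^sub>F m in sequentially. (\<integral>\<^sup>+\<omega>. norm (f \<omega> - s m \<omega>) \<partial>M) < ennreal (\<epsilon> / 2)"
      using order_tendstoD(2)[OF lim, of "ennreal (\<epsilon> / 2)"] by simp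
    then obtain m0 where m0: "\<And>m. m \<ge> m0 \<Longrightarrow> (\<integral>\<^sup>+\<omega>. norm (f \<omega> - s m \<omega>) \<partial>M) < ennreal (\<epsilon> / 2)"
      by (auto simp: eventually_sequentially)
    have "norm (?I m - ?I n) < \<epsilon>" if "m \<ge> m0" "n \<ge> m0" for m n
    proof -
      have "ennreal (norm (?I m - ?I n)) < ennreal (\<epsilon> / 2) + ennreal (\<epsilon> / 2)"
        using dist_I[of m n] add_strict_mono[OF m0[OF that(1)] m0[OF that(2)]] by (rule le_less_trans)
      also have "\<dots> = ennreal \<epsilon>"
        using \<open>\<epsilon> > 0\<close> by (simp flip: ennreal_plus)
      finally show ?thesis by (simp add: ennreal_less_iff)
    qed
    then show "\<exists>m0. \<forall>m\<ge>m0. \<forall>n\<ge>m0. norm (?I m - ?I n) < \<epsilon>" by blast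
  qed
  then obtain x where "?I \<longlonglongrightarrow> x"
    using Cauchy_convergent convergent_def by blast
  with f sbi lim show ?thesis unfolding has_bochner_int_def by blast
qed

lemma bochner_int_inner:
  fixes f :: "'a \<Rightarrow> 'h"
  assumes "finite_measure M" "f \<in> borel_measurable M" "(\<integral>\<^sup>+\<omega>. norm (f \<omega>) \<partial>M) < \<infinity>"
  shows "has_bochner_int M f (bochner_int M f)"
    and "inner (bochner_int M f) g = (\<integral>\<omega>. inner (f \<omega>) g \<partial>M)"
proof -
  obtain x where x: "has_bochner_int M f x"
    using has_bochner_int_exists[OF assms] by blast
  then have "bochner_int M f = x"
    unfolding bochner_int_def using has_bochner_int_unique by (auto intro!: the_equality)
  with x show "has_bochner_int M f (bochner_int M f)" by simp
  from has_bochner_int_inner[OF this, of g]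
  show "inner (bochner_int M f) g = (\<integral>\<omega>. inner (f \<omega>) g \<partial>M)"
    by (simp add: has_bochner_integral_iff)
qed

end

section \<open>Tightness and convergence of trigonometric functionals\<close>

text \<open>The phase b lets one constructor cover constants (t = 0), sines and cosines, and it
  makes the class closed under products.\<close>

inductive trigonometric :: "('h::real_inner \<Rightarrow> real) \<Rightarrow> bool" where
  cos: "trigonometric (\<lambda>x. a * cos (inner x t + b))"
| add: "trigonometric p \<Longrightarrow> trigonometric q \<Longrightarrow> trigonometric (\<lambda>x. p x + q x)"

lemma trigonometric_const: "trigonometric (\<lambda>x. c)"
  using trigonometric.cos[of c 0 0] by simp

text \<open>The product of two cosines is half the sum of the cosines of the difference and of the
  sum of their arguments.\<close>

lemma trigonometric_mult_cos:
  "trigonometric p \<Longrightarrow> trigonometric (\<lambda>x. p x * (a * cos (inner x t + b)))"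
proof (induction rule: trigonometric.induct)
  case (cos a' t' b')
  have "(a' * cos (inner x t' + b')) * (a * cos (inner x t + b))
      = a' * a / 2 * cos (inner x (t' - t) + (b' - b)) + a' * a / 2 * cos (inner x (t' + t) + (b' + b))" for x
  proof -
    have "inner x (t' - t) + (b' - b) = (inner x t' + b') - (inner x t + b)"
      "inner x (t' + t) + (b' + b) = (inner x t' + b') + (inner x t + b)"
      by (simp_all add: inner_diff_right inner_add_right)
    then show ?thesis by (simp only: cos_diff cos_add) (simp add: algebra_simps)
  qed
  then show ?case by (simp only: trigonometric.intros)
qed (simp add: distrib_right trigonometric.add)

lemma trigonometric_mult: "trigonometric q \<Longrightarrow> trigonometric p \<Longrightarrow> trigonometric (\<lambda>x. p x * q x)"
  by (induction rule: trigonometric.induct)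
     (auto simp: distrib_left trigonometric_mult_cos intro: trigonometric.add)

text \<open>This allows an approximation to be clamped afterwards without leaving the class.\<close>

lemma trigonometric_poly:
  assumes "trigonometric p" "real_polynomial_function q"
  shows "trigonometric (\<lambda>x. q (p x))"
  using assms(2)
proof (induction rule: real_polynomial_function.induct)
  case (linear f)
  then obtain c where "f = (\<lambda>x. x * c)" by (auto simp: real_bounded_linear)
  then show ?case using trigonometric_mult[OF trigonometric_const assms(1)] by simp
qed (auto intro: trigonometric_const trigonometric_mult trigonometric.add)

lemma trigonometric_continuous: "trigonometric p \<Longrightarrow> continuous_on S p"
  by (induction rule: trigonometric.induct) (intro continuous_intros; assumption)+

lemma trigonometric_bounded:
  assumes "trigonometric p"
  obtains D where "\<And>x. \<bar>p x\<bar> \<le> D"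
proof -
  from assms have "\<exists>D. \<forall>x. \<bar>p x\<bar> \<le> D"
  proof (induction rule: trigonometric.induct)
    case (cos a t b)
    then show ?case
      by (intro exI[of _ "\<bar>a\<bar>"]) (auto simp: abs_mult intro!: mult_left_le)
  next
    case (add p q)
    then obtain D E where "\<And>x. \<bar>p x\<bar> \<le> D" "\<And>x. \<bar>q x\<bar> \<le> E" by blast
    then show ?case
      by (intro exI[of _ "D + E"]) (auto intro: order_trans[OF abs_triangle_ineq] add_mono)
  qed
  with that show thesis by blast
qed

lemma trigonometric_separates:
  assumes "x \<noteq> y"
  shows "\<exists>p. trigonometric p \<and> p x \<noteq> p y"
proof -
  \<comment> \<open>The scaling and the phase used below make the argument pi / 2 at x and 0 at y,
    so the cosine takes the values 0 and 1.\<close>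
  define t where "t = (pi / 2 / (norm (x - y))\<^sup>2) *\<^sub>R (x - y)"
  have "inner (x - y) t = pi / 2"
    using assms by (simp add: t_def power2_norm_eq_inner)
  then have "inner x t + - inner y t = pi / 2" by (simp add: inner_diff_left)
  then have "1 * cos (inner x t + - inner y t) \<noteq> 1 * cos (inner y t + - inner y t)"
    by (simp only: cos_pi_half) simp
  with trigonometric.cos[of 1 t "- inner y t"] show ?thesis by blast
qed

text \<open>Composing a Stone--Weierstrass approximation with a polynomial close to the clamping function
  keeps it close to \<open>\<phi>\<close> on \<open>K\<close> and bounds it globally by a constant that does not depend on \<open>K\<close>.\<close>

lemma trigonometric_approx_on_compact:
  fixes \<phi> :: "'h::real_inner \<Rightarrow> real"
  assumes K: "compact K" and cont: "continuous_on K \<phi>" and B: "\<And>x. \<bar>\<phi> x\<bar> \<le> B" and "\<epsilon> > 0"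
  obtains p where "trigonometric p" "\<And>x. x \<in> K \<Longrightarrow> \<bar>\<phi> x - p x\<bar> < \<epsilon>" "\<And>x. \<bar>p x\<bar> < B + \<epsilon>"
proof -
  have "\<epsilon> / 2 > 0" using \<open>\<epsilon> > 0\<close> by simp
  have "\<exists>p. trigonometric p \<and> (\<forall>x\<in>K. \<bar>\<phi> x - p x\<bar> < \<epsilon> / 2)"
    by (rule Stone_Weierstrass_HOL[OF K _ _ _ _ _ cont \<open>\<epsilon> / 2 > 0\<close>])
       (auto intro: trigonometric_const trigonometric.add trigonometric_mult trigonometric_continuous
         trigonometric_separates)
  then obtain p where p: "trigonometric p" "\<And>x. x \<in> K \<Longrightarrow> \<bar>\<phi> x - p x\<bar> < \<epsilon> / 2" by blast
  obtain D where D: "\<And>x. \<bar>p x\<bar> \<le> D" using trigonometric_bounded[OF p(1)] by blast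
  define clamp where "clamp s = max (- B) (min B s)" for s :: real
  have "continuous_on {-D..D} clamp" unfolding clamp_def by (intro continuous_intros)
  then obtain q where q: "real_polynomial_function q" "\<And>s. s \<in> {-D..D} \<Longrightarrow> \<bar>clamp s - q s\<bar> < \<epsilon> / 2"
    using Stone_Weierstrass_real_polynomial_function[OF compact_Icc _ \<open>\<epsilon> / 2 > 0\<close>] by blast
  have "B \<ge> 0" using B[of 0] by linarith
  have pq: "\<bar>clamp (p x) - q (p x)\<bar> < \<epsilon> / 2" for x
    using D[of x] by (intro q) auto
  show thesis
  proof (rule that)
    show "trigonometric (\<lambda>x. q (p x))" using p(1) q(1) by (rule trigonometric_poly)
    show "\<bar>\<phi> x - q (p x)\<bar> < \<epsilon>" if "x \<in> K" for x
    proof -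
      \<comment> \<open>Clamping is 1-Lipschitz and fixes the value of \<phi> at x, which lies in
        [-B, B].\<close>
      have "\<bar>\<phi> x - clamp (p x)\<bar> \<le> \<bar>\<phi> x - p x\<bar>"
        using B[of x] unfolding clamp_def by linarith
      with p(2)[OF that] pq[of x] show ?thesis by linarith
    qed
    show "\<bar>q (p x)\<bar> < B + \<epsilon>" for x
    proof -
      have "\<bar>clamp (p x)\<bar> \<le> B" using \<open>B \<ge> 0\<close> unfolding clamp_def by linarith
      with pq[of x] \<open>\<epsilon> > 0\<close> show ?thesis by linarith
    qed
  qed
qed

section \<open>Compact sets described by coordinates\<close>

context hilbert_basis
begin

text \<open>The set is a Minkowski sum of m compact segments.\<close>

lemma compact_sum_basis: "compact ((\<lambda>a. \<Sum>i<m. a i *\<^sub>R e i) ` {a. \<forall>i<m. \<bar>a i\<bar> \<le> R})"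
proof (induction m)
  case 0
  then show ?case by (cases "{a::nat \<Rightarrow> real. \<forall>i<0. \<bar>a i\<bar> \<le> R} = {}") auto
next
  case (Suc m)
  let ?S = "\<lambda>m. (\<lambda>a. \<Sum>i<m. a i *\<^sub>R e i) ` {a. \<forall>i<m. \<bar>a i\<bar> \<le> R}"
  have "compact ((\<lambda>c. c *\<^sub>R e m) ` {-R..R})"
    by (intro compact_continuous_image continuous_intros compact_Icc)
  with Suc have "compact {x + y | x y. x \<in> ?S m \<and> y \<in> (\<lambda>c. c *\<^sub>R e m) ` {-R..R}}"
    by (rule compact_sums)
  moreover have "?S (Suc m) = {x + y | x y. x \<in> ?S m \<and> y \<in> (\<lambda>c. c *\<^sub>R e m) ` {-R..R}}" (is "_ = ?T")
  proof (intro subset_antisym subsetI)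
    fix z assume "z \<in> ?S (Suc m)"
    then obtain a where "\<forall>i<Suc m. \<bar>a i\<bar> \<le> R" "z = (\<Sum>i<m. a i *\<^sub>R e i) + a m *\<^sub>R e m" by auto
    then show "z \<in> ?T" by (force simp: abs_le_iff)
  next
    fix z assume "z \<in> ?T"
    then obtain x c where x: "x \<in> ?S m" and c: "c \<in> {-R..R}" and z: "z = x + c *\<^sub>R e m" by blast
    from x obtain a where "\<forall>i<m. \<bar>a i\<bar> \<le> R" "x = (\<Sum>i<m. a i *\<^sub>R e i)" by blast
    with c z have a: "\<forall>i<m. \<bar>a i\<bar> \<le> R" "\<bar>c\<bar> \<le> R" "z = (\<Sum>i<m. a i *\<^sub>R e i) + c *\<^sub>R e m"
      by auto
    then have "z = (\<Sum>i<Suc m. (a(m := c)) i *\<^sub>R e i)" by simp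
    moreover have "\<forall>i<Suc m. \<bar>(a(m := c)) i\<bar> \<le> R" using a by (simp add: less_Suc_eq)
    ultimately show "z \<in> ?S (Suc m)" by blast
  qed
  ultimately show ?case by simp
qed

text \<open>Once r j is below half of the tolerance, each point of the set is that close to its
  projection, and the projections lie in one compact box because R bounds every coefficient. So the
  set is totally bounded, and it is closed in a complete space.\<close>

lemma compact_proj_residual_le:
  fixes m :: "nat \<Rightarrow> nat"
  assumes "r \<longlonglongrightarrow> 0"
  shows "compact {x. norm x \<le> R \<and> (\<forall>j. norm (x - proj (m j) x) \<le> r j)}" (is "compact ?K")
  unfolding compact_eq_totally_bounded
proof
  have "?K = {x. norm x \<le> R} \<inter> (\<Inter>j. {x. norm (x - proj (m j) x) \<le> r j})" by auto
  also have "closed \<dots>"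
    by (intro closed_Int closed_INT ballI closed_Collect_le continuous_intros)
  finally show "Topological_Spaces.complete ?K" by (simp add: complete_eq_closed)
  show "\<forall>\<epsilon>>0. \<exists>k. finite k \<and> ?K \<subseteq> (\<Union>x\<in>k. ball x \<epsilon>)"
  proof (intro allI impI)
    fix \<epsilon> :: real assume "\<epsilon> > 0"
    then have "\<forall>\<^sub>F j in sequentially. r j < \<epsilon> / 2"
      using order_tendstoD(2)[OF assms, of "\<epsilon> / 2"] by simp
    then obtain j where j: "r j < \<epsilon> / 2" by (auto simp: eventually_sequentially)
    let ?S = "(\<lambda>a. \<Sum>i<m j. a i *\<^sub>R e i) ` {a. \<forall>i<m j. \<bar>a i\<bar> \<le> R}"
    obtain k where k: "finite k" "?S \<subseteq> (\<Union>x\<in>k. ball x (\<epsilon> / 2))"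
      using compact_sum_basis[of "m j" R, unfolded compact_eq_totally_bounded, THEN conjunct2, rule_format, of "\<epsilon> / 2"]
        \<open>\<epsilon> > 0\<close> by auto
    have "x \<in> (\<Union>y\<in>k. ball y \<epsilon>)" if "x \<in> ?K" for x
    proof -
      have "\<bar>inner x (e i)\<bar> \<le> R" for i
      proof -
        have "\<bar>inner x (e i)\<bar> \<le> norm x * norm (e i)" by (rule Cauchy_Schwarz_ineq2)
        also have "norm (e i) \<le> 1" using unit[of i] by (auto simp: norm_eq_sqrt_inner)
        finally show ?thesis using that by (simp add: mult_left_mono)
      qed
      then have "proj (m j) x \<in> ?S"
        unfolding proj_def by (intro image_eqI[where x="\<lambda>i. inner x (e i)"]) auto
      then obtain y where "y \<in> k" "dist y (proj (m j) x) < \<epsilon> / 2" using k by auto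
      moreover have "dist x (proj (m j) x) < \<epsilon> / 2"
        using that le_less_trans[OF _ j, of "norm (x - proj (m j) x)"] unfolding dist_norm by blast
      ultimately have "dist y x < \<epsilon>"
        using dist_triangle_half_l[of y "proj (m j) x" \<epsilon> x] by (simp add: dist_commute)
      with \<open>y \<in> k\<close> show ?thesis by auto
    qed
    with k(1) show "\<exists>k. finite k \<and> ?K \<subseteq> (\<Union>x\<in>k. ball x \<epsilon>)" by blast
  qed
qed

end

section \<open>Uniform tightness from summable second moments\<close>

context hilbert_basis
begin

text \<open>Chebyshev for the tail of the expansion. Of Y only the majorant c enters the bound, so
  the same estimate serves all members of a sequence and its limit.\<close>

lemma emeasure_proj_residual_le:
  fixes Y :: "'a \<Rightarrow> 'h"
  assumes Y: "Y \<in> borel_measurable M"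
    and c: "\<And>i. (\<integral>\<^sup>+\<omega>. ennreal ((inner (Y \<omega>) (e i))\<^sup>2) \<partial>M) \<le> ennreal (c i)"
      "summable c" "\<And>i. 0 \<le> c i"
    and r: "r > 0" and le: "(\<Sum>i. c (i + m)) \<le> \<delta> * r\<^sup>2"
  shows "emeasure M {\<omega>\<in>space M. norm (Y \<omega> - proj m (Y \<omega>)) > r} \<le> ennreal \<delta>"
proof -
  have [measurable]: "(\<lambda>\<omega>. inner (Y \<omega>) (e i)) \<in> borel_measurable M" for i
    using Y by (rule borel_measurable_inner_right)
  have [measurable]: "(\<lambda>\<omega>. norm (Y \<omega> - proj m (Y \<omega>))) \<in> borel_measurable M"
  proof (rule norm_diff_measurable)
    show "(\<lambda>\<omega>. inner (proj m (Y \<omega>)) (e i)) \<in> borel_measurable M" for i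
      unfolding proj_def inner_sum_left inner_scaleR_left by measurable
  qed measurable
  have "emeasure M {\<omega>\<in>space M. norm (Y \<omega> - proj m (Y \<omega>)) > r}
      = (\<integral>\<^sup>+\<omega>. indicator {\<omega>\<in>space M. norm (Y \<omega> - proj m (Y \<omega>)) > r} \<omega> \<partial>M)"
    by (simp add: nn_integral_indicator)
  also have "\<dots> \<le> (\<integral>\<^sup>+\<omega>. ennreal (1 / r\<^sup>2) * ennreal ((norm (Y \<omega> - proj m (Y \<omega>)))\<^sup>2) \<partial>M)"
  proof (intro nn_integral_mono)
    fix \<omega>
    have "1 \<le> 1 / r\<^sup>2 * (norm (Y \<omega> - proj m (Y \<omega>)))\<^sup>2" if "norm (Y \<omega> - proj m (Y \<omega>)) > r"
      using r that power_strict_mono[OF that, of 2] by simp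
    then show "indicator {\<omega>\<in>space M. norm (Y \<omega> - proj m (Y \<omega>)) > r} \<omega>
        \<le> ennreal (1 / r\<^sup>2) * ennreal ((norm (Y \<omega> - proj m (Y \<omega>)))\<^sup>2)"
      using r by (auto simp: indicator_def simp flip: ennreal_mult ennreal_1 intro!: ennreal_leI)
  qed
  also have "\<dots> = ennreal (1 / r\<^sup>2) * (\<integral>\<^sup>+\<omega>. ennreal ((norm (Y \<omega> - proj m (Y \<omega>)))\<^sup>2) \<partial>M)"
    by (rule nn_integral_cmult) measurable
  also have "(\<integral>\<^sup>+\<omega>. ennreal ((norm (Y \<omega> - proj m (Y \<omega>)))\<^sup>2) \<partial>M)
      = (\<integral>\<^sup>+\<omega>. (\<Sum>i. ennreal ((inner (Y \<omega>) (e (i + m)))\<^sup>2)) \<partial>M)"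
    using proj_residual_sums by (intro nn_integral_cong) (simp add: suminf_ennreal2 sums_iff)
  also have "\<dots> = (\<Sum>i. \<integral>\<^sup>+\<omega>. ennreal ((inner (Y \<omega>) (e (i + m)))\<^sup>2) \<partial>M)"
    by (rule nn_integral_suminf) measurable
  also have "\<dots> \<le> (\<Sum>i. ennreal (c (i + m)))"
    by (intro suminf_le c(1)) auto
  also have "\<dots> = ennreal (\<Sum>i. c (i + m))"
    using c by (intro suminf_ennreal2) (auto simp: summable_iff_shift)
  also have "ennreal (1 / r\<^sup>2) * \<dots> = ennreal (1 / r\<^sup>2 * (\<Sum>i. c (i + m)))"
    by (rule ennreal_mult'[symmetric]) simp
  also have "\<dots> \<le> ennreal \<delta>"
    using le r by (intro ennreal_leI) (simp add: divide_le_eq)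
  finally show ?thesis by (simp add: mult_left_mono)
qed

text \<open>A union bound: the ball contributes \<delta>, and the j-th tail condition contributes
  \<delta> / 2^(j+1).\<close>

lemma prob_outside_le:
  fixes Y :: "'a \<Rightarrow> 'h"
  assumes "prob_space M" and Y: "Y \<in> borel_measurable M"
    and c: "\<And>i. (\<integral>\<^sup>+\<omega>. ennreal ((inner (Y \<omega>) (e i))\<^sup>2) \<partial>M) \<le> ennreal (c i)"
      "summable c" "\<And>i. 0 \<le> c i"
    and R: "R > 0" "suminf c \<le> \<delta> * R\<^sup>2"
    and r: "\<And>j. r j > 0" "\<And>j. (\<Sum>i. c (i + m j)) \<le> \<delta> * (1 / 2) ^ Suc j * (r j)\<^sup>2"
    and "\<delta> \<ge> 0"
  shows "measure M {\<omega>\<in>space M. Y \<omega> \<notin> {x. norm x \<le> R \<and> (\<forall>j. norm (x - proj (m j) x) \<le> r j)}} \<le> 2 * \<delta>"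
proof -
  interpret prob_space M by fact
  \<comment> \<open>\<open>proj 0\<close> is 0, so this is the event that the norm exceeds R, and
    the tail estimate applies to it as well.\<close>
  let ?A = "{\<omega>\<in>space M. norm (Y \<omega> - proj 0 (Y \<omega>)) > R}"
  let ?B = "\<lambda>j. {\<omega>\<in>space M. norm (Y \<omega> - proj (m j) (Y \<omega>)) > r j}"
  have Ym: "(\<lambda>\<omega>. inner (Y \<omega>) (e i)) \<in> borel_measurable M" for i
    using Y by (rule borel_measurable_inner_right)
  have nm [measurable]: "(\<lambda>\<omega>. norm (Y \<omega> - proj l (Y \<omega>))) \<in> borel_measurable M" for l
    by (rule norm_diff_measurable[OF Ym])
       (use Ym in \<open>auto simp: proj_def inner_sum_left intro!: borel_measurable_sum borel_measurable_times\<close>)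
  have "emeasure M {\<omega>\<in>space M. Y \<omega> \<notin> {x. norm x \<le> R \<and> (\<forall>j. norm (x - proj (m j) x) \<le> r j)}}
      = emeasure M (?A \<union> (\<Union>j. ?B j))"
    by (rule arg_cong[where f="emeasure M"]) (auto simp: proj_def not_le)
  also have "\<dots> \<le> emeasure M ?A + emeasure M (\<Union>j. ?B j)"
    by (rule emeasure_subadditive) measurable
  also have "emeasure M (\<Union>j. ?B j) \<le> (\<Sum>j. emeasure M (?B j))"
    by (rule emeasure_subadditive_countably) auto
  also have "(\<Sum>j. emeasure M (?B j)) \<le> (\<Sum>j. ennreal (\<delta> * (1 / 2) ^ Suc j))"
    using Y c r by (intro suminf_le emeasure_proj_residual_le) auto
  also have "\<dots> = ennreal \<delta>"
  proof -
    have "(\<lambda>j. \<delta> * (1 / 2) ^ Suc j) sums (\<delta> * 1)"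
      by (intro sums_mult power_half_series)
    then show ?thesis using \<open>\<delta> \<ge> 0\<close> by (subst suminf_ennreal2) (auto simp: sums_iff)
  qed
  also have "emeasure M ?A \<le> ennreal \<delta>"
    using Y c R by (intro emeasure_proj_residual_le) auto
  finally have "emeasure M {\<omega>\<in>space M. Y \<omega> \<notin> {x. norm x \<le> R \<and> (\<forall>j. norm (x - proj (m j) x) \<le> r j)}}
      \<le> ennreal (2 * \<delta>)"
    using \<open>\<delta> \<ge> 0\<close> by (simp add: add_mono flip: ennreal_plus)
  then show ?thesis
    using \<open>\<delta> \<ge> 0\<close> by (simp add: emeasure_eq_measure)
qed

end

section \<open>From trigonometric functions to all bounded continuous functions\<close>

lemma (in prob_space) abs_expectation_diff_le:
  fixes f g :: "'a \<Rightarrow> real"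
  assumes [measurable]: "f \<in> borel_measurable M" "g \<in> borel_measurable M" "A \<in> sets M"
    and out: "\<And>\<omega>. \<omega> \<in> space M \<Longrightarrow> \<omega> \<notin> A \<Longrightarrow> \<bar>f \<omega> - g \<omega>\<bar> \<le> \<epsilon>"
    and bd: "\<And>\<omega>. \<bar>f \<omega>\<bar> \<le> B" "\<And>\<omega>. \<bar>g \<omega>\<bar> \<le> B'"
    and "prob A \<le> \<eta>" "\<epsilon> \<ge> 0"
  shows "\<bar>expectation f - expectation g\<bar> \<le> \<epsilon> + (B + B') * \<eta>"
proof -
  have int: "integrable M f" "integrable M g"
    using integrable_const_bound[of f B] integrable_const_bound[of g B'] bd by auto
  have "B + B' \<ge> 0" using bd[of undefined] by linarith
  have "\<bar>expectation f - expectation g\<bar> = \<bar>\<integral>\<omega>. f \<omega> - g \<omega> \<partial>M\<bar>"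
    using int by simp
  also have "\<dots> \<le> (\<integral>\<omega>. \<bar>f \<omega> - g \<omega>\<bar> \<partial>M)"
    by (rule integral_abs_bound)
  also have "\<dots> \<le> (\<integral>\<omega>. \<epsilon> + (B + B') * indicator A \<omega> \<partial>M)"
  proof (rule integral_mono)
    show "\<bar>f \<omega> - g \<omega>\<bar> \<le> \<epsilon> + (B + B') * indicator A \<omega>" if "\<omega> \<in> space M" for \<omega>
      using out[OF that] bd[of \<omega>] \<open>\<epsilon> \<ge> 0\<close> by (auto simp: indicator_def)
    show "integrable M (\<lambda>\<omega>. \<epsilon> + (B + B') * indicator A \<omega>)"
      by (intro Bochner_Integration.integrable_add integrable_const integrable_mult_right integrable_real_indicator)
         (auto simp: less_top[symmetric])
  qed (use int in auto)
  also have "\<dots> = \<epsilon> + (B + B') * prob A"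
    by (subst Bochner_Integration.integral_add) (auto simp: prob_space less_top[symmetric])
  also have "\<dots> \<le> \<epsilon> + (B + B') * \<eta>"
    using \<open>B + B' \<ge> 0\<close> \<open>prob A \<le> \<eta>\<close> by (simp add: mult_left_mono)
  finally show ?thesis .
qed

lemma trigonometric_measurable:
  assumes "trigonometric p" "Y \<in> borel_measurable M"
  shows "(\<lambda>\<omega>. p (Y \<omega>)) \<in> borel_measurable M"
  by (rule measurable_compose[OF assms(2)])
     (intro borel_measurable_continuous_onI trigonometric_continuous assms(1))

lemma (in prob_space) trigonometric_integrable:
  assumes "trigonometric p" "Y \<in> borel_measurable M"
  shows "integrable M (\<lambda>\<omega>. p (Y \<omega>))"
proof -
  obtain D where "\<And>x. \<bar>p x\<bar> \<le> D" using trigonometric_bounded[OF assms(1)] by blast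
  then show ?thesis
    using trigonometric_measurable[OF assms] by (intro integrable_const_bound[where B=D]) auto
qed

lemma trigonometric_expectation_tendsto:
  assumes "prob_space M" "prob_space N" "\<And>n. Y n \<in> borel_measurable M" "Z \<in> borel_measurable N"
    and cos: "\<And>t b. (\<lambda>n. \<integral>\<omega>. cos (inner (Y n \<omega>) t + b) \<partial>M) \<longlonglongrightarrow> (\<integral>\<omega>. cos (inner (Z \<omega>) t + b) \<partial>N)"
    and "trigonometric p"
  shows "(\<lambda>n. \<integral>\<omega>. p (Y n \<omega>) \<partial>M) \<longlonglongrightarrow> (\<integral>\<omega>. p (Z \<omega>) \<partial>N)"
  using \<open>trigonometric p\<close>
proof (induction rule: trigonometric.induct)
  case (cos a t b)
  show ?case by (simp add: tendsto_mult_left assms(5))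
next
  case (add p q)
  then have "(\<lambda>n. (\<integral>\<omega>. p (Y n \<omega>) \<partial>M) + (\<integral>\<omega>. q (Y n \<omega>) \<partial>M)) \<longlonglongrightarrow> (\<integral>\<omega>. p (Z \<omega>) \<partial>N) + (\<integral>\<omega>. q (Z \<omega>) \<partial>N)"
    by (intro tendsto_add)
  then show ?case
    using prob_space.trigonometric_integrable[OF assms(1) _ assms(3)]
      prob_space.trigonometric_integrable[OF assms(2) _ assms(4)] add.hyps
    by simp
qed

text \<open>A bounded continuous function is replaced by one trigonometric p. Its expectations move
  by at most a quarter of the tolerance, uniformly in n and for Z; a further quarter is spent on the
  convergence for p.\<close>

theorem (in hilbert_basis) converges_in_distributionI:
  fixes Y :: "nat \<Rightarrow> 'w \<Rightarrow> 'h" and Z :: "'a \<Rightarrow> 'h"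
  assumes M: "prob_space M" and N: "prob_space N"
    and Y: "\<And>n. Y n \<in> borel_measurable M" and Z: "Z \<in> borel_measurable N"
    and c: "summable c" "\<And>i. 0 \<le> c i"
    and cY: "\<And>n i. (\<integral>\<^sup>+\<omega>. ennreal ((inner (Y n \<omega>) (e i))\<^sup>2) \<partial>M) \<le> ennreal (c i)"
    and cZ: "\<And>i. (\<integral>\<^sup>+\<omega>. ennreal ((inner (Z \<omega>) (e i))\<^sup>2) \<partial>N) \<le> ennreal (c i)"
    and cos: "\<And>t b. (\<lambda>n. \<integral>\<omega>. cos (inner (Y n \<omega>) t + b) \<partial>M) \<longlonglongrightarrow> (\<integral>\<omega>. cos (inner (Z \<omega>) t + b) \<partial>N)"
  shows "converges_in_distribution M Y N Z"
  unfolding converges_in_distribution_def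
proof (intro conjI allI impI Y Z)
  fix \<phi> :: "'h \<Rightarrow> real" assume \<phi>: "continuous_on UNIV \<phi>" "bounded (range \<phi>)"
  then obtain B where B: "\<And>x. \<bar>\<phi> x\<bar> \<le> B" by (auto simp: bounded_iff)
  then have "B \<ge> 0" using B[of 0] by linarith
  have \<phi>m [measurable]: "\<phi> \<in> borel_measurable borel"
    using \<phi>(1) by (rule borel_measurable_continuous_onI)
  show "(\<lambda>n. \<integral>\<omega>. \<phi> (Y n \<omega>) \<partial>M) \<longlonglongrightarrow> (\<integral>\<omega>. \<phi> (Z \<omega>) \<partial>N)"
  proof (rule LIMSEQ_I)
    fix \<epsilon>0 :: real assume "\<epsilon>0 > 0"
    \<comment> \<open>The bound 1 keeps p within B + 1; the eighth is the share of the error on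
      K.\<close>
    define \<epsilon> where "\<epsilon> = min 1 (\<epsilon>0 / 8)"
    \<comment> \<open>Outside K the two functions differ by at most 2 * B + 1, on an event of
      probability at most 2 * \<delta>; the product is the other eighth.\<close>
    define \<delta> where "\<delta> = \<epsilon>0 / (16 * (2 * B + 1))"
    have pos: "\<epsilon> > 0" "\<delta> > 0" using \<open>\<epsilon>0 > 0\<close> \<open>B \<ge> 0\<close> by (auto simp: \<epsilon>_def \<delta>_def)
    define r where "r j = 1 / real (Suc j)" for j
    have r: "r j > 0" for j by (simp add: r_def)
    have r0: "r \<longlonglongrightarrow> 0" unfolding r_def by (rule LIMSEQ_Suc) (rule lim_1_over_n)
    have "\<exists>l. (\<Sum>i. c (i + l)) \<le> \<delta> * (1 / 2) ^ Suc j * (r j)\<^sup>2" for j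
    proof -
      have "(\<lambda>l. \<Sum>i. c (i + l)) \<longlonglongrightarrow> 0" using c(1) by (rule suminf_exist_split2)
      then have "\<forall>\<^sub>F l in sequentially. (\<Sum>i. c (i + l)) < \<delta> * (1 / 2) ^ Suc j * (r j)\<^sup>2"
        by (rule order_tendstoD) (use pos r[of j] in simp)
      then show ?thesis by (auto simp: eventually_sequentially intro: less_imp_le)
    qed
    then obtain m where m: "\<And>j. (\<Sum>i. c (i + m j)) \<le> \<delta> * (1 / 2) ^ Suc j * (r j)\<^sup>2" by metis
    \<comment> \<open>The added 1 keeps R positive when all c i are 0.\<close>
    define R where "R = sqrt ((suminf c + 1) / \<delta>)"
    have "suminf c \<ge> 0" using c by (intro suminf_nonneg)
    then have R: "R > 0" "suminf c \<le> \<delta> * R\<^sup>2" using pos by (auto simp: R_def)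
    define K where "K = {x. norm x \<le> R \<and> (\<forall>j. norm (x - proj (m j) x) \<le> r j)}"
    have K: "compact K" unfolding K_def by (rule compact_proj_residual_le[OF r0])
    then have [measurable]: "K \<in> sets borel" by (intro borel_closed compact_imp_closed)
    obtain p where p: "trigonometric p" "\<And>x. x \<in> K \<Longrightarrow> \<bar>\<phi> x - p x\<bar> < \<epsilon>" "\<And>x. \<bar>p x\<bar> < B + \<epsilon>"
      using trigonometric_approx_on_compact[OF K continuous_on_subset[OF \<phi>(1) subset_UNIV] B pos(1)] by blast
    have pB: "\<bar>p x\<bar> \<le> B + 1" for x using p(3)[of x] by (simp add: \<epsilon>_def)
    have small: "\<epsilon> + (B + (B + 1)) * (2 * \<delta>) \<le> \<epsilon>0 / 4"
    proof -
      have "(B + (B + 1)) * (2 * \<delta>) = \<epsilon>0 / 8"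
        using \<open>B \<ge> 0\<close> by (simp add: \<delta>_def field_simps)
      then show ?thesis by (simp add: \<epsilon>_def)
    qed
    have dY: "\<bar>(\<integral>\<omega>. \<phi> (Y n \<omega>) \<partial>M) - (\<integral>\<omega>. p (Y n \<omega>) \<partial>M)\<bar> \<le> \<epsilon>0 / 4" for n
    proof -
      note [measurable] = Y[of n]
      have "\<bar>(\<integral>\<omega>. \<phi> (Y n \<omega>) \<partial>M) - (\<integral>\<omega>. p (Y n \<omega>) \<partial>M)\<bar> \<le> \<epsilon> + (B + (B + 1)) * (2 * \<delta>)"
        by (rule prob_space.abs_expectation_diff_le[OF M, where A="{\<omega>\<in>space M. Y n \<omega> \<notin> K}"])
           (use p(2) pos B pB in \<open>auto intro!: less_imp_le trigonometric_measurable[OF p(1) Y]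
             prob_outside_le[OF M Y cY c R r m, folded K_def]\<close>)
      with small show ?thesis by linarith
    qed
    have dZ: "\<bar>(\<integral>\<omega>. \<phi> (Z \<omega>) \<partial>N) - (\<integral>\<omega>. p (Z \<omega>) \<partial>N)\<bar> \<le> \<epsilon>0 / 4"
    proof -
      note [measurable] = Z
      have "\<bar>(\<integral>\<omega>. \<phi> (Z \<omega>) \<partial>N) - (\<integral>\<omega>. p (Z \<omega>) \<partial>N)\<bar> \<le> \<epsilon> + (B + (B + 1)) * (2 * \<delta>)"
        by (rule prob_space.abs_expectation_diff_le[OF N, where A="{\<omega>\<in>space N. Z \<omega> \<notin> K}"])
           (use p(2) pos B pB in \<open>auto intro!: less_imp_le trigonometric_measurable[OF p(1) Z]
             prob_outside_le[OF N Z cZ c R r m, folded K_def]\<close>)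
      with small show ?thesis by linarith
    qed
    have "\<exists>n0. \<forall>n\<ge>n0. \<bar>(\<integral>\<omega>. p (Y n \<omega>) \<partial>M) - (\<integral>\<omega>. p (Z \<omega>) \<partial>N)\<bar> < \<epsilon>0 / 4"
      using LIMSEQ_D[OF trigonometric_expectation_tendsto[OF M N Y Z cos p(1)], of "\<epsilon>0 / 4"] \<open>\<epsilon>0 > 0\<close>
      by simp
    then obtain n0 where n0: "\<And>n. n \<ge> n0 \<Longrightarrow> \<bar>(\<integral>\<omega>. p (Y n \<omega>) \<partial>M) - (\<integral>\<omega>. p (Z \<omega>) \<partial>N)\<bar> < \<epsilon>0 / 4" by blast
    have "\<bar>(\<integral>\<omega>. \<phi> (Y n \<omega>) \<partial>M) - (\<integral>\<omega>. \<phi> (Z \<omega>) \<partial>N)\<bar> < \<epsilon>0" if "n \<ge> n0" for n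
      using dY[of n] dZ n0[OF that] by linarith
    then show "\<exists>n0. \<forall>n\<ge>n0. norm ((\<integral>\<omega>. \<phi> (Y n \<omega>) \<partial>M) - (\<integral>\<omega>. \<phi> (Z \<omega>) \<partial>N)) < \<epsilon>0"
      by auto
  qed
qed

section \<open>Gaussian measures with a given covariance form\<close>

text \<open>As a scaled image of the standard normal law it also covers v = 0, where it is the point
  mass at 0.\<close>

definition centred_normal :: "real \<Rightarrow> real measure" where
  "centred_normal v = distr std_normal_distribution borel (\<lambda>x. sqrt v * x)"

lemma real_distribution_centred_normal: "real_distribution (centred_normal v)"
  unfolding centred_normal_def using real_dist_normal_dist
  by (intro prob_space.real_distribution_distr) (auto simp: real_distribution_def)

lemma char_centred_normal:
  assumes "v \<ge> 0"
  shows "char (centred_normal v) t = exp (- (t\<^sup>2 * v) / 2)"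
proof -
  have "char (centred_normal v) t = char std_normal_distribution (t * sqrt v)"
    unfolding centred_normal_def char_def by (subst integral_distr) (auto simp: mult.assoc)
  also have "\<dots> = exp (- (t\<^sup>2 * v) / 2)"
    using assms by (simp add: char_std_normal_distribution power_mult_distrib)
  finally show ?thesis .
qed

lemma gaussian_law_centred_normal:
  assumes "v \<ge> 0"
  shows "gaussian_law (centred_normal v)"
proof (cases "v = 0")
  case True
  interpret real_distribution std_normal_distribution by (rule real_dist_normal_dist)
  have "centred_normal v = return borel 0"
    by (simp add: True centred_normal_def)
  then show ?thesis unfolding gaussian_law_def by blast
next
  case False
  with assms have "v > 0" by simp
  interpret real_distribution std_normal_distribution by (rule real_dist_normal_dist)
  have "distributed std_normal_distribution lborel (\<lambda>x. x) (normal_density 0 1)"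
    by (auto simp: distributed_def intro!: measure_eqI simp: emeasure_distr)
  then have "distributed std_normal_distribution lborel (\<lambda>x. 0 + sqrt v * x) (normal_density (0 + sqrt v * 0) (\<bar>sqrt v\<bar> * 1))"
    by (rule normal_density_affine) (use \<open>v > 0\<close> in auto)
  then have "distr std_normal_distribution lborel (\<lambda>x. sqrt v * x) = density lborel (normal_density 0 (sqrt v))"
    using \<open>v > 0\<close> by (simp add: distributed_def)
  moreover have "distr std_normal_distribution lborel (\<lambda>x. sqrt v * x) = centred_normal v"
    unfolding centred_normal_def by (intro distr_cong) auto
  ultimately show ?thesis
    using \<open>v > 0\<close> unfolding gaussian_law_def by (metis real_sqrt_gt_zero)
qed

lemma has_bochner_integral_std_normal:
  "has_bochner_integral std_normal_distribution (\<lambda>x. x) 0"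
  "has_bochner_integral std_normal_distribution (\<lambda>x. x\<^sup>2) 1"
proof -
  show "has_bochner_integral std_normal_distribution (\<lambda>x. x) 0"
    using std_normal_moment_odd[of 0] by (intro has_bochner_integral_density) auto
  show "has_bochner_integral std_normal_distribution (\<lambda>x. x\<^sup>2) 1"
    using std_normal_moment_even[of 1] by (intro has_bochner_integral_density) (auto simp: fact_numeral)
qed

lemma centred_normal_moments:
  assumes X: "X \<in> borel_measurable M" and D: "distr M borel X = centred_normal v" and "v \<ge> 0"
  shows "has_bochner_integral M X 0"
    and "has_bochner_integral M (\<lambda>\<omega>. (X \<omega>)\<^sup>2) v"
proof -
  have *: "has_bochner_integral M (\<lambda>\<omega>. g (X \<omega>)) c"
    if "has_bochner_integral std_normal_distribution (\<lambda>x. g (sqrt v * x)) c"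
      and [measurable]: "g \<in> borel_measurable borel" for g :: "real \<Rightarrow> real" and c
  proof -
    have "has_bochner_integral (distr M borel X) g c"
      unfolding D centred_normal_def using that(1) by (intro has_bochner_integral_distr) auto
    then show ?thesis using X by (simp add: has_bochner_integral_iff integrable_distr_eq integral_distr)
  qed
  show "has_bochner_integral M X 0"
    using has_bochner_integral_mult_right[OF has_bochner_integral_std_normal(1), of "sqrt v"]
    by (intro *[of "\<lambda>x. x"]) auto
  show "has_bochner_integral M (\<lambda>\<omega>. (X \<omega>)\<^sup>2) v"
    using has_bochner_integral_mult_right[OF has_bochner_integral_std_normal(2), of v] \<open>v \<ge> 0\<close>
    by (intro *[of "\<lambda>x. x\<^sup>2"]) (auto simp: power_mult_distrib)
qed

lemma (in prob_space) distr_eq_centred_normalI: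
  assumes "X \<in> borel_measurable M" "v \<ge> 0"
    and "\<And>t. char (distr M borel X) t = exp (- (t\<^sup>2 * v) / 2)"
  shows "distr M borel X = centred_normal v"
  using assms
  by (intro Levy_uniqueness real_distribution_centred_normal real_distribution_distr ext)
     (auto simp: char_centred_normal)

text \<open>Almost sure convergence gives pointwise convergence of the characteristic functions,
  with the constant 1 as dominating function; the limit is then identified by its characteristic
  function.\<close>

lemma (in prob_space) distr_centred_normal_limit:
  fixes X :: "nat \<Rightarrow> 'a \<Rightarrow> real"
  assumes X: "\<And>m. X m \<in> borel_measurable M" and Y: "Y \<in> borel_measurable M"
    and D: "\<And>m. distr M borel (X m) = centred_normal (v m)" and v: "\<And>m. v m \<ge> 0" "v \<longlonglongrightarrow> w"
    and lim: "AE \<omega> in M. (\<lambda>m. X m \<omega>) \<longlonglongrightarrow> Y \<omega>"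
  shows "distr M borel Y = centred_normal w"
proof (rule distr_eq_centred_normalI[OF Y])
  show "w \<ge> 0" using v by (intro LIMSEQ_le_const) auto
  fix t
  have *: "char (distr M borel V) t = (\<integral>\<omega>. iexp (t * V \<omega>) \<partial>M)" if "V \<in> borel_measurable M" for V
    unfolding char_def using that by (subst integral_distr) auto
  have "(\<lambda>m. \<integral>\<omega>. iexp (t * X m \<omega>) \<partial>M) \<longlonglongrightarrow> (\<integral>\<omega>. iexp (t * Y \<omega>) \<partial>M)"
  proof (rule integral_dominated_convergence[where w="\<lambda>_. 1"])
    show "AE \<omega> in M. (\<lambda>m. iexp (t * X m \<omega>)) \<longlonglongrightarrow> iexp (t * Y \<omega>)"
      using lim by eventually_elim (intro tendsto_intros; assumption)
  qed (use X Y in auto)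
  then have "(\<lambda>m. char (centred_normal (v m)) t) \<longlonglongrightarrow> char (distr M borel Y) t"
    using *[OF X] *[OF Y] D by simp
  moreover have "(\<lambda>m. char (centred_normal (v m)) t) \<longlonglongrightarrow> exp (- (t\<^sup>2 * w) / 2)"
  proof -
    have "(\<lambda>m. complex_of_real (exp (- (t\<^sup>2 * v m) / 2))) \<longlonglongrightarrow> complex_of_real (exp (- (t\<^sup>2 * w) / 2))"
      by (intro tendsto_intros v(2)) simp
    then show ?thesis using v(1) by (simp add: char_centred_normal)
  qed
  ultimately show "char (distr M borel Y) t = exp (- (t\<^sup>2 * w) / 2)"
    by (rule LIMSEQ_unique)
qed

section \<open>White noise and Gaussian coordinates\<close>

definition white_noise :: "(nat \<Rightarrow> real) measure" where
  "white_noise = PiM UNIV (\<lambda>_. std_normal_distribution)"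

lemma prob_space_white_noise: "prob_space white_noise"
  unfolding white_noise_def using real_dist_normal_dist
  by (intro prob_space_PiM) (auto simp: real_distribution_def)

lemma white_noise_component [measurable]: "(\<lambda>\<omega>. \<omega> i) \<in> borel_measurable white_noise"
proof -
  have "(\<lambda>\<omega>. \<omega> i) \<in> measurable white_noise std_normal_distribution"
    unfolding white_noise_def by (rule measurable_component_singleton) simp
  then show ?thesis by simp
qed

lemma distr_white_noise_component: "distr white_noise borel (\<lambda>\<omega>. \<omega> i) = std_normal_distribution"
proof -
  have "distr white_noise borel (\<lambda>\<omega>. \<omega> i) = distr white_noise std_normal_distribution (\<lambda>\<omega>. \<omega> i)"
    by (intro distr_cong) auto
  also have "\<dots> = std_normal_distribution"
    unfolding white_noise_def using real_dist_normal_dist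
    by (intro distr_PiM_component) (auto simp: real_distribution_def)
  finally show ?thesis .
qed

lemma indep_white_noise: "prob_space.indep_vars white_noise (\<lambda>_. borel) (\<lambda>i \<omega>. \<omega> i) UNIV"
proof -
  interpret prob_space white_noise by (rule prob_space_white_noise)
  have "distr white_noise (PiM UNIV (\<lambda>_. borel)) (\<lambda>\<omega>. \<lambda>i\<in>UNIV. \<omega> i) = distr white_noise white_noise (\<lambda>\<omega>. \<omega>)"
    by (intro distr_cong) (auto simp: white_noise_def cong: sets_PiM_cong)
  then show ?thesis
    by (subst indep_vars_iff_distr_eq_PiM) (simp_all add: distr_white_noise_component white_noise_def[symmetric])
qed

text \<open>By independence the characteristic functions multiply, and the exponents add up to the
  sum of squares.\<close>

lemma distr_white_noise_sum:
  "distr white_noise borel (\<lambda>\<omega>. \<Sum>i<m. a i * \<omega> i) = centred_normal (\<Sum>i<m. (a i)\<^sup>2)"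
proof -
  interpret prob_space white_noise by (rule prob_space_white_noise)
  have ind: "indep_vars (\<lambda>_. borel) (\<lambda>i \<omega>. a i * \<omega> i) {..<m}"
    using indep_vars_subset[OF indep_vars_compose2[OF indep_white_noise, of "\<lambda>i x. a i * x" "\<lambda>_. borel"]] by auto
  have *: "char (distr white_noise borel (\<lambda>\<omega>. a i * \<omega> i)) t = exp (- (t * a i)\<^sup>2 / 2)" for i t
  proof -
    have "char (distr white_noise borel (\<lambda>\<omega>. a i * \<omega> i)) t = char (distr white_noise borel (\<lambda>\<omega>. \<omega> i)) (t * a i)"
      unfolding char_def by (simp add: integral_distr mult.assoc)
    then show ?thesis by (simp add: distr_white_noise_component char_std_normal_distribution)
  qed
  show ?thesis
  proof (rule distr_eq_centred_normalI)
    fix t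
    show "char (distr white_noise borel (\<lambda>\<omega>. \<Sum>i<m. a i * \<omega> i)) t = exp (- (t\<^sup>2 * (\<Sum>i<m. (a i)\<^sup>2)) / 2)"
      unfolding char_distr_sum[OF ind] *
      by (simp add: exp_sum[symmetric] power_mult_distrib sum_distrib_left sum_divide_distrib sum_negf flip: of_real_prod)
  qed (auto intro: sum_nonneg)
qed

context psd_form
begin

lemma gram_schmidt_later: "n < j \<Longrightarrow> b (d n) (gram_schmidt d j) = 0"
  using gram_schmidt_expand[of n j d "gram_schmidt d j"] by (simp add: gram_schmidt_orthogonal)

text \<open>Row n of the Cholesky factor applied to white noise. The row is finite because the
  factor is lower triangular, so no convergence question arises.\<close>

definition gaussian_coord :: "(nat \<Rightarrow> 'v) \<Rightarrow> nat \<Rightarrow> (nat \<Rightarrow> real) \<Rightarrow> real" where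
  "gaussian_coord d n \<omega> = (\<Sum>i\<le>n. b (d n) (gram_schmidt d i) * \<omega> i)"

lemma gaussian_coord_measurable [measurable]: "gaussian_coord d n \<in> borel_measurable white_noise"
  unfolding gaussian_coord_def by measurable

text \<open>All rows can be extended to length m by zeros. After exchanging the sums, the i-th noise
  variable has coefficient \<open>b x (gram_schmidt d i)\<close>, and the squares of these add up to
  \<open>b x x\<close>.\<close>

lemma distr_gaussian_coord_sum:
  fixes a d m
  defines "x \<equiv> (\<Sum>n<m. a n *\<^sub>R d n)"
  shows "distr white_noise borel (\<lambda>\<omega>. \<Sum>n<m. a n * gaussian_coord d n \<omega>) = centred_normal (b x x)"
proof -
  have "(\<Sum>n<m. a n * gaussian_coord d n \<omega>) = (\<Sum>i<m. b x (gram_schmidt d i) * \<omega> i)" for \<omega>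
  proof -
    have "gaussian_coord d n \<omega> = (\<Sum>i<m. b (d n) (gram_schmidt d i) * \<omega> i)" if "n < m" for n
      unfolding gaussian_coord_def using that
      by (intro sum.mono_neutral_left) (auto simp: gram_schmidt_later)
    then have "(\<Sum>n<m. a n * gaussian_coord d n \<omega>)
        = (\<Sum>n<m. \<Sum>i<m. a n * b (d n) (gram_schmidt d i) * \<omega> i)"
      by (simp add: sum_distrib_left mult.assoc)
    also have "\<dots> = (\<Sum>i<m. \<Sum>n<m. a n * b (d n) (gram_schmidt d i) * \<omega> i)"
      by (rule sum.swap)
    also have "\<dots> = (\<Sum>i<m. b x (gram_schmidt d i) * \<omega> i)"
      by (simp add: x_def sum_left scale_left sum_distrib_right)
    finally show ?thesis .
  qed
  then show ?thesis
    using distr_white_noise_sum[of "\<lambda>i. b x (gram_schmidt d i)" m] gram_schmidt_span_expand[of a d m]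
    by (simp add: x_def)
qed

lemma distr_gaussian_coord: "distr white_noise borel (gaussian_coord d n) = centred_normal (b (d n) (d n))"
  using distr_gaussian_coord_sum[of "\<lambda>i. if i = n then 1 else 0" d "Suc n"]
  by (simp add: if_distrib[of "\<lambda>c. c * _"] if_distrib[of "\<lambda>c. c *\<^sub>R _"] cong: if_cong)

end

section \<open>The Gaussian measure of a bounded form with finite trace\<close>

locale trace_class_form = hilbert_basis e + psd_form b
  for e :: "nat \<Rightarrow> 'h::{real_inner,banach}" and b :: "'h \<Rightarrow> 'h \<Rightarrow> real" +
  fixes \<kappa> :: real
  assumes bound: "b f f \<le> \<kappa> * (norm f)\<^sup>2"
    and summable_diag: "summable (\<lambda>i. b (e i) (e i))"
begin

text \<open>The sign of \<kappa> is not assumed, hence the absolute value.\<close>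

lemma abs_le: "\<bar>b f g\<bar> \<le> \<bar>\<kappa>\<bar> * (norm f * norm g)"
proof -
  have *: "b f f \<le> \<bar>\<kappa>\<bar> * (norm f)\<^sup>2" for f
    using bound[of f] by (rule order_trans) (simp add: mult_right_mono)
  have "(b f g)\<^sup>2 \<le> b f f * b g g" by (rule Cauchy_Schwarz)
  also have "\<dots> \<le> (\<bar>\<kappa>\<bar> * (norm f)\<^sup>2) * (\<bar>\<kappa>\<bar> * (norm g)\<^sup>2)"
    by (intro mult_mono * nonneg) simp
  also have "\<dots> = (\<bar>\<kappa>\<bar> * (norm f * norm g))\<^sup>2"
    by (simp add: power2_eq_square)
  finally have "\<bar>b f g\<bar>\<^sup>2 \<le> (\<bar>\<kappa>\<bar> * (norm f * norm g))\<^sup>2" by simp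
  then show ?thesis by (rule power2_le_imp_le) simp
qed

lemma proj_form_tendsto: "(\<lambda>m. b (proj m f) g) \<longlonglongrightarrow> b f g"
proof -
  have "(\<lambda>m. b (proj m f - f) g) \<longlonglongrightarrow> 0"
  proof (rule tendsto_0_le[where K="\<bar>\<kappa>\<bar> * norm g"])
    show "(\<lambda>m. norm (proj m f - f)) \<longlonglongrightarrow> 0"
      using proj_tendsto[of f] by (simp add: LIM_zero tendsto_norm_zero)
  qed (use abs_le[of "proj _ f - f" g] in \<open>auto simp: mult_ac\<close>)
  then show ?thesis by (simp add: diff_left LIM_zero_iff)
qed

text \<open>The difference of the two values factors as
  \<open>b (proj m f - f) (proj m f + f)\<close>, whose first argument tends to 0 while the second
  stays bounded.\<close>

lemma proj_self_form_tendsto: "(\<lambda>m. b (proj m f) (proj m f)) \<longlonglongrightarrow> b f f"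
proof -
  have "(\<lambda>m. \<bar>\<kappa>\<bar> * (norm (proj m f - f) * norm (proj m f + f))) \<longlonglongrightarrow> \<bar>\<kappa>\<bar> * (norm (f - f) * norm (f + f))"
    by (intro tendsto_intros proj_tendsto)
  then have *: "(\<lambda>m. \<bar>\<kappa>\<bar> * (norm (proj m f - f) * norm (proj m f + f))) \<longlonglongrightarrow> 0" by simp
  have "(\<lambda>m. b (proj m f - f) (proj m f + f)) \<longlonglongrightarrow> 0"
    by (rule tendsto_0_le[OF *, where K=1]) (use abs_le in \<open>auto simp: abs_mult\<close>)
  moreover have "b (proj m f - f) (proj m f + f) = b (proj m f) (proj m f) - b f f" for m
    by (simp add: diff_left add_right sym[of f "proj m f"])
  ultimately show ?thesis by (simp add: LIM_zero_iff)
qed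

definition coord_finite :: "(nat \<Rightarrow> real) \<Rightarrow> bool" where
  "coord_finite \<omega> \<longleftrightarrow> (\<Sum>n. ennreal ((gaussian_coord e n \<omega>)\<^sup>2)) \<noteq> \<top>"

text \<open>The value 0 on the exceptional null event gives every coordinate an explicit measurable
  formula.\<close>

definition gaussian_series :: "(nat \<Rightarrow> real) \<Rightarrow> 'h" where
  "gaussian_series \<omega> = (if coord_finite \<omega> then \<Sum>n. gaussian_coord e n \<omega> *\<^sub>R e n else 0)"

text \<open>The expected sum of squares is the trace of the form, which is finite.\<close>

lemma AE_coord_finite: "AE \<omega> in white_noise. coord_finite \<omega>"
proof -
  have "(\<integral>\<^sup>+\<omega>. ennreal ((gaussian_coord e n \<omega>)\<^sup>2) \<partial>white_noise) = ennreal (b (e n) (e n))" for n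
  proof -
    have "has_bochner_integral white_noise (\<lambda>\<omega>. (gaussian_coord e n \<omega>)\<^sup>2) (b (e n) (e n))"
      by (rule centred_normal_moments) (auto simp: distr_gaussian_coord nonneg)
    then show ?thesis
      by (subst nn_integral_eq_integral) (auto simp: has_bochner_integral_iff)
  qed
  then have "(\<integral>\<^sup>+\<omega>. (\<Sum>n. ennreal ((gaussian_coord e n \<omega>)\<^sup>2)) \<partial>white_noise) = (\<Sum>n. ennreal (b (e n) (e n)))"
    by (subst nn_integral_suminf) auto
  also have "\<dots> = ennreal (\<Sum>n. b (e n) (e n))"
    by (intro suminf_ennreal2 nonneg summable_diag)
  finally have "AE \<omega> in white_noise. (\<Sum>n. ennreal ((gaussian_coord e n \<omega>)\<^sup>2)) \<noteq> \<infinity>"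
    by (intro nn_integral_noteq_infinite) auto
  then show ?thesis by (simp add: coord_finite_def)
qed

lemma inner_gaussian_series:
  "inner (gaussian_series \<omega>) (e i) = (if coord_finite \<omega> then gaussian_coord e i \<omega> * inner (e i) (e i) else 0)"
proof -
  have "inner (\<Sum>n. gaussian_coord e n \<omega> *\<^sub>R e n) (e i) = gaussian_coord e i \<omega> * inner (e i) (e i)"
    if "coord_finite \<omega>"
    using that unfolding coord_finite_def
    by (intro inner_suminf_basis summable_basis summable_suminf_not_top) auto
  then show ?thesis by (simp add: gaussian_series_def)
qed

lemma gaussian_series_measurable: "gaussian_series \<in> borel_measurable white_noise"
proof (rule borel_measurable_coeffI)
  have [measurable]: "Measurable.pred white_noise coord_finite"
    unfolding coord_finite_def by measurable
  show "(\<lambda>\<omega>. inner (gaussian_series \<omega>) (e i)) \<in> borel_measurable white_noise" for i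
    unfolding inner_gaussian_series by measurable
qed

text \<open>Pairing with \<open>proj m f\<close> gives a finite combination of coordinates, whose
  law is known. Almost sure convergence and continuity of the form then carry the law over to
  f.\<close>

lemma distr_inner_gaussian_series:
  "distr white_noise borel (\<lambda>\<omega>. inner (gaussian_series \<omega>) f) = centred_normal (b f f)"
proof -
  interpret prob_space white_noise by (rule prob_space_white_noise)
  show ?thesis
  proof (rule distr_centred_normal_limit)
    show "(\<lambda>\<omega>. \<Sum>n<m. inner f (e n) * gaussian_coord e n \<omega>) \<in> borel_measurable white_noise" for m
      by measurable
    show "(\<lambda>\<omega>. inner (gaussian_series \<omega>) f) \<in> borel_measurable white_noise"
      by (intro borel_measurable_inner_right gaussian_series_measurable)
    show "distr white_noise borel (\<lambda>\<omega>. \<Sum>n<m. inner f (e n) * gaussian_coord e n \<omega>)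
        = centred_normal (b (proj m f) (proj m f))" for m
      by (simp add: distr_gaussian_coord_sum proj_def)
    show "AE \<omega> in white_noise. (\<lambda>m. \<Sum>n<m. inner f (e n) * gaussian_coord e n \<omega>) \<longlonglongrightarrow> inner (gaussian_series \<omega>) f"
      using AE_coord_finite
    proof eventually_elim
      case (elim \<omega>)
      \<comment> \<open>If \<open>e n = 0\<close>, then \<open>inner f (e n)\<close> is 0 too, so
        padding vectors contribute nothing on either side.\<close>
      have "inner f (e n) * (gaussian_coord e n \<omega> * inner (e n) (e n)) = inner f (e n) * gaussian_coord e n \<omega>" for n
        by (metis coeff_mult_self mult.assoc mult.commute)
      then have "inner (gaussian_series \<omega>) (proj m f) = (\<Sum>n<m. inner f (e n) * gaussian_coord e n \<omega>)" for m
        by (simp only: proj_def inner_sum_right inner_scaleR_right inner_gaussian_series elim if_True)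
      then show ?case
        using tendsto_inner[OF tendsto_const[of "gaussian_series \<omega>"] proj_tendsto[of f]] by simp
    qed
  qed (auto intro: nonneg proj_self_form_tendsto)
qed

text \<open>The law is moved to \<open>'h\<close> so that the identity map becomes the Gaussian
  element.\<close>

definition gaussian_measure :: "'h measure" where
  "gaussian_measure = distr white_noise borel gaussian_series"

lemma prob_space_gaussian_measure: "prob_space gaussian_measure"
  unfolding gaussian_measure_def
  by (rule prob_space.prob_space_distr[OF prob_space_white_noise gaussian_series_measurable])

lemma id_measurable_gaussian_measure: "(\<lambda>z. z) \<in> borel_measurable gaussian_measure"
  by (simp add: gaussian_measure_def)

lemma inner_measurable_gaussian_measure [measurable]: "(\<lambda>z. inner z f) \<in> borel_measurable gaussian_measure"
  by (intro borel_measurable_inner_right id_measurable_gaussian_measure)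

lemma distr_gaussian_measure: "distr gaussian_measure borel (\<lambda>z. inner z f) = centred_normal (b f f)"
proof -
  have [measurable]: "(\<lambda>z. inner z f) \<in> borel_measurable borel"
    by (intro borel_measurable_continuous_onI continuous_intros)
  show ?thesis
    unfolding gaussian_measure_def
    by (subst distr_distr) (auto simp: comp_def gaussian_series_measurable distr_inner_gaussian_series)
qed

lemma gaussian_element_gaussian_measure: "gaussian_element gaussian_measure (\<lambda>z. z)"
  unfolding gaussian_element_def
  by (simp add: prob_space_gaussian_measure id_measurable_gaussian_measure distr_gaussian_measure
      gaussian_law_centred_normal nonneg)

lemma gaussian_measure_mean: "has_bochner_integral gaussian_measure (\<lambda>z. inner z f) 0"
  by (rule centred_normal_moments(1)[OF _ distr_gaussian_measure nonneg]) measurable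

lemma gaussian_measure_variance: "has_bochner_integral gaussian_measure (\<lambda>z. (inner z f)\<^sup>2) (b f f)"
  by (rule centred_normal_moments(2)[OF _ distr_gaussian_measure nonneg]) measurable

lemma gaussian_measure_second_moment:
  "(\<integral>\<^sup>+z. ennreal ((inner z f)\<^sup>2) \<partial>gaussian_measure) = ennreal (b f f)"
  using gaussian_measure_variance[of f]
  by (subst nn_integral_eq_integral) (auto simp: has_bochner_integral_iff)

text \<open>Polarisation of the variance.\<close>

lemma gaussian_measure_covariance:
  "has_bochner_integral gaussian_measure (\<lambda>z. inner z f * inner z g) (b f g)"
proof -
  have "has_bochner_integral gaussian_measure
      (\<lambda>z. ((inner z (f + g))\<^sup>2 - (inner z f)\<^sup>2 - (inner z g)\<^sup>2) / 2) ((b (f + g) (f + g) - b f f - b g g) / 2)"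
    by (intro has_bochner_integral_divide_zero has_bochner_integral_diff gaussian_measure_variance)
  moreover have "((inner z (f + g))\<^sup>2 - (inner z f)\<^sup>2 - (inner z g)\<^sup>2) / 2 = inner z f * inner z g" for z
    by (simp add: inner_add_right power2_eq_square algebra_simps)
  moreover have "(b (f + g) (f + g) - b f f - b g g) / 2 = b f g"
    by (simp add: add_left add_right sym[of g f])
  ultimately show ?thesis by simp
qed

text \<open>The Bochner mean requires an integrable norm. By Parseval the second moment of the norm
  is the trace, so the norm is integrable; all coordinates of the mean are 0.\<close>

lemma has_mean_zero_gaussian_measure: "has_mean_zero gaussian_measure (\<lambda>z. z)"
proof -
  interpret prob_space gaussian_measure by (rule prob_space_gaussian_measure)
  have [measurable]: "(\<lambda>z. norm z) \<in> borel_measurable gaussian_measure"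
    by (rule norm_measurable) measurable
  have "(\<integral>\<^sup>+z. ennreal ((norm z)\<^sup>2) \<partial>gaussian_measure)
      = (\<integral>\<^sup>+z. (\<Sum>i. ennreal ((inner z (e i))\<^sup>2)) \<partial>gaussian_measure)"
    using Parseval by (intro nn_integral_cong) (simp add: suminf_ennreal2 sums_iff)
  also have "\<dots> = (\<Sum>i. ennreal (b (e i) (e i)))"
    by (subst nn_integral_suminf) (auto simp: gaussian_measure_second_moment)
  also have "\<dots> = ennreal (\<Sum>i. b (e i) (e i))"
    by (intro suminf_ennreal2 nonneg summable_diag)
  finally have sq: "(\<integral>\<^sup>+z. ennreal ((norm z)\<^sup>2) \<partial>gaussian_measure) = ennreal (\<Sum>i. b (e i) (e i))" .
  have "(\<integral>\<^sup>+z. norm z \<partial>gaussian_measure) \<le> (\<integral>\<^sup>+z. 1 + ennreal ((norm z)\<^sup>2) \<partial>gaussian_measure)"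
  proof (intro nn_integral_mono)
    fix z :: 'h
    have "0 \<le> (norm z - 1)\<^sup>2 + (norm z)\<^sup>2 + 1" by simp
    then have "norm z \<le> 1 + (norm z)\<^sup>2" by (simp add: power2_eq_square algebra_simps)
    then show "ennreal (norm z) \<le> 1 + ennreal ((norm z)\<^sup>2)"
      by (simp add: ennreal_leI flip: ennreal_plus ennreal_1)
  qed
  also have "\<dots> = 1 + ennreal (\<Sum>i. b (e i) (e i))"
    by (subst nn_integral_add) (auto simp: sq emeasure_space_1)
  also have "\<dots> < \<infinity>" by (simp add: less_top)
  finally obtain x where x: "has_bochner_int gaussian_measure (\<lambda>z. z) x"
    using has_bochner_int_exists[OF finite_measure_axioms id_measurable_gaussian_measure] by blast
  have "inner x (e i) = inner 0 (e i)" for i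
    using has_bochner_integral_eq[OF has_bochner_int_inner[OF x] gaussian_measure_mean] by simp
  then have "x = 0" by (rule coeff_eqI)
  with x show ?thesis by (simp add: has_mean_zero_def)
qed

section \<open>The covariance operator\<close>

text \<open>The Riesz representative of the functional \<open>b f\<close>, written in the
  basis.\<close>

definition form_operator :: "'h \<Rightarrow> 'h" where
  "form_operator f = (\<Sum>n. b f (e n) *\<^sub>R e n)"

text \<open>Cauchy-Schwarz for \<open>b\<close> and the finite trace make the coefficients square
  summable. The identity then holds on basis vectors and extends along \<open>proj m g\<close>, both
  sides being continuous.\<close>

lemma inner_form_operator: "inner (form_operator f) g = b f g"
proof -
  have "summable (\<lambda>n. (b f (e n))\<^sup>2)"
  proof (rule summable_comparison_test')
    show "summable (\<lambda>n. b f f * b (e n) (e n))" by (intro summable_mult summable_diag)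
    show "norm ((b f (e n))\<^sup>2) \<le> b f f * b (e n) (e n)" if "n \<ge> 0" for n
      using Cauchy_Schwarz[of f "e n"] by simp
  qed
  then have e: "inner (form_operator f) (e n) = b f (e n)" for n
    unfolding form_operator_def using unit[of n]
    by (subst inner_suminf_basis[OF summable_basis]) (auto simp: zero_right)
  have p: "inner (form_operator f) (proj m g) = b (proj m g) f" for m
    by (simp add: proj_def inner_sum_right e sum_left scale_left sym[of f])
  have "(\<lambda>m. inner (form_operator f) (proj m g)) \<longlonglongrightarrow> b g f"
    unfolding p by (rule proj_form_tendsto)
  moreover have "(\<lambda>m. inner (form_operator f) (proj m g)) \<longlonglongrightarrow> inner (form_operator f) g"
    by (intro tendsto_intros proj_tendsto)
  ultimately show ?thesis using LIMSEQ_unique sym by metis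
qed

text \<open>\<open>L1_plus\<close> asks for a genuine orthonormal basis, so the padding zeros of
  \<open>e\<close> are removed; the trace along the rest is part of the summable diagonal.\<close>

lemma form_operator_L1_plus: "form_operator \<in> L1_plus"
proof -
  have "bounded_linear form_operator"
  proof (rule bounded_linear_intro[where K="\<bar>\<kappa>\<bar>"])
    show "form_operator (f + g) = form_operator f + form_operator g" for f g
      by (rule coeff_eqI) (simp add: inner_add_left inner_form_operator add_left)
    show "form_operator (c *\<^sub>R f) = c *\<^sub>R form_operator f" for c f
      by (rule coeff_eqI) (simp add: inner_form_operator scale_left)
    show "norm (form_operator f) \<le> norm f * \<bar>\<kappa>\<bar>" for f
    proof (cases "form_operator f = 0")
      case False
      \<comment> \<open>The bound on the form is applied with the image of f as second argument; one
        factor of its norm then cancels.\<close>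
      have "(norm (form_operator f))\<^sup>2 \<le> \<bar>\<kappa>\<bar> * (norm f * norm (form_operator f))"
        using abs_le[of f "form_operator f"] by (simp add: power2_norm_eq_inner inner_form_operator)
      with False show ?thesis by (simp add: power2_eq_square mult_ac)
    qed simp
  qed
  moreover have "\<exists>B. orthonormal_basis B \<and> (\<lambda>x. inner (form_operator x) x) summable_on B"
  proof (intro exI conjI)
    let ?I = "{i. e i \<noteq> 0}"
    have nz: "inner (e i) (e i) = 1" if "e i \<noteq> 0" for i using unit[of i] that by auto
    show "orthonormal_basis (e ` ?I)"
      unfolding orthonormal_basis_def
    proof (intro conjI)
      show "pairwise orthogonal (e ` ?I)"
        by (auto simp: pairwise_def orthogonal_def intro!: orth)
      show "\<forall>x\<in>e ` ?I. norm x = 1" by (auto simp: norm_eq_sqrt_inner nz)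
      have "proj m f \<in> span (e ` ?I)" for m f
        unfolding proj_def
      proof (intro span_sum span_scale)
        show "e i \<in> span (e ` ?I)" for i by (cases "e i = 0") (auto intro: span_base span_zero)
      qed
      then have "x \<in> closure (span (e ` ?I))" for x
        unfolding closure_sequential using proj_tendsto[of x] by (intro exI[of _ "\<lambda>m. proj m x"]) simp
      then show "closure (span (e ` ?I)) = UNIV" by blast
    qed
    \<comment> \<open>Equal unit vectors at different indices would be orthogonal to
      themselves.\<close>
    have "inj_on e ?I"
      using orth nz by (intro inj_onI) (metis mem_Collect_eq zero_neq_one)
    moreover have "(\<lambda>i. b (e i) (e i)) summable_on ?I"
    proof (rule summable_on_subset_banach)
      show "(\<lambda>i. b (e i) (e i)) summable_on UNIV"
        using summable_diag nonneg by (intro norm_summable_imp_summable_on) simp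
    qed simp
    ultimately show "(\<lambda>x. inner (form_operator x) x) summable_on (e ` ?I)"
      by (simp add: summable_on_reindex comp_def inner_form_operator)
  qed
  ultimately show ?thesis
    by (auto simp: L1_plus_def inner_form_operator nonneg inner_commute[of _ "form_operator _"] intro: sym)
qed

lemma has_covariance_operator_gaussian_measure:
  "has_covariance_operator gaussian_measure (\<lambda>z. z) form_operator"
  using gaussian_measure_mean gaussian_measure_covariance
  by (simp add: has_covariance_operator_def inner_form_operator has_bochner_integral_iff)

end

section \<open>The one-dimensional central limit theorem\<close>

locale iid_square_integrable = prob_space +
  fixes \<xi> :: "nat \<Rightarrow> 'a \<Rightarrow> real" and \<mu> :: "real measure" and m v :: real
  assumes indep: "indep_vars (\<lambda>_. borel) \<xi> UNIV"
    and distr: "distr M borel (\<xi> i) = \<mu>"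
    and sq_int: "integrable M (\<lambda>\<omega>. (\<xi> i \<omega>)\<^sup>2)"
    and mean: "expectation (\<xi> i) = m"
    and var: "variance (\<xi> i) = v"
begin

lemma \<xi>_measurable [measurable]: "\<xi> i \<in> borel_measurable M"
  using indep by (auto simp: indep_vars_def)

lemma \<xi>_integrable: "integrable M (\<xi> i)"
  by (rule square_integrable_imp_integrable[OF \<xi>_measurable sq_int])

definition normalised_sum :: "nat \<Rightarrow> 'a \<Rightarrow> real" where
  "normalised_sum n \<omega> = (\<Sum>i<n. \<xi> i \<omega> - m) / sqrt n"

lemma normalised_sum_measurable [measurable]: "normalised_sum n \<in> borel_measurable M"
  unfolding normalised_sum_def by measurable

lemma v_nonneg: "v \<ge> 0"
  using variance_positive[of "\<xi> 0"] by (simp add: var)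

lemma centred_product:
  "has_bochner_integral M (\<lambda>\<omega>. (\<xi> i \<omega> - m) * (\<xi> j \<omega> - m)) (if i = j then v else 0)"
proof (cases "i = j")
  case True
  have "integrable M (\<lambda>\<omega>. (\<xi> i \<omega>)\<^sup>2 - 2 * m * \<xi> i \<omega> + m\<^sup>2)"
    by (intro Bochner_Integration.integrable_add Bochner_Integration.integrable_diff sq_int
        integrable_mult_right \<xi>_integrable integrable_const)
  then have "integrable M (\<lambda>\<omega>. (\<xi> i \<omega> - m) * (\<xi> i \<omega> - m))"
    by (simp add: power2_eq_square algebra_simps)
  then show ?thesis
    using True var[of i] mean[of i] by (simp add: has_bochner_integral_iff power2_eq_square)
next
  case False
  have ind: "indep_vars (\<lambda>_. borel) (\<lambda>l \<omega>. \<xi> l \<omega> - m) {i, j}"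
    using indep_vars_subset[OF indep_vars_compose2[OF indep, of "\<lambda>_ x. x - m" "\<lambda>_. borel"]] by auto
  have int: "integrable M (\<lambda>\<omega>. \<xi> l \<omega> - m)" for l
    by (intro Bochner_Integration.integrable_diff \<xi>_integrable integrable_const)
  have "expectation (\<lambda>\<omega>. \<xi> l \<omega> - m) = 0" for l
    using \<xi>_integrable[of l] by (simp add: mean prob_space)
  then show ?thesis
    using indep_vars_lebesgue_integral[OF _ ind int] indep_vars_integrable[OF _ ind int] False
    by (simp add: has_bochner_integral_iff)
qed

text \<open>Independence removes the cross terms and leaves n * v / n. Only an inequality holds in
  general, because the sum is 0 for n = 0.\<close>

lemma normalised_sum_second_moment:
  "(\<integral>\<^sup>+\<omega>. ennreal ((normalised_sum n \<omega>)\<^sup>2) \<partial>M) \<le> ennreal v"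
proof (cases "n = 0")
  case False
  have sq: "(normalised_sum n \<omega>)\<^sup>2 = (\<Sum>i<n. \<Sum>j<n. (\<xi> i \<omega> - m) * (\<xi> j \<omega> - m)) / n" for \<omega>
    using False by (simp add: normalised_sum_def power_divide power2_eq_square[of "\<Sum>i<n. _ i"] sum_product)
  have "has_bochner_integral M (\<lambda>\<omega>. (normalised_sum n \<omega>)\<^sup>2) ((\<Sum>i<n. \<Sum>j<n. if i = j then v else 0) / n)"
    unfolding sq by (intro has_bochner_integral_divide_zero has_bochner_integral_sum centred_product)
  then have "has_bochner_integral M (\<lambda>\<omega>. (normalised_sum n \<omega>)\<^sup>2) v"
    using False by simp
  then show ?thesis
    by (subst nn_integral_eq_integral) (auto simp: has_bochner_integral_iff)
qed (simp add: normalised_sum_def)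

text \<open>The central limit theorem needs positive variance. For v = 0 the second moment bound
  makes the sums vanish almost surely, in accordance with the point mass as limit.\<close>

lemma normalised_sum_cos_tendsto:
  "(\<lambda>n. expectation (\<lambda>\<omega>. cos (normalised_sum n \<omega> + c))) \<longlonglongrightarrow> (\<integral>x. cos (x + c) \<partial>centred_normal v)"
proof (cases "v = 0")
  case True
  have zero: "AE \<omega> in M. normalised_sum n \<omega> = 0" for n
  proof -
    have "(\<integral>\<^sup>+\<omega>. ennreal ((normalised_sum n \<omega>)\<^sup>2) \<partial>M) = 0"
      using normalised_sum_second_moment[of n] True by simp
    then show ?thesis
      by (subst (asm) nn_integral_0_iff_AE) auto
  qed
  have "expectation (\<lambda>\<omega>. cos (normalised_sum n \<omega> + c)) = expectation (\<lambda>\<omega>. cos c)" for n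
  proof (rule integral_cong_AE)
    show "AE \<omega> in M. cos (normalised_sum n \<omega> + c) = cos c"
      using zero[of n] by eventually_elim simp
  qed measurable
  moreover have "(\<integral>x. cos (x + c) \<partial>centred_normal v) = cos c"
  proof -
    interpret N: real_distribution std_normal_distribution by (rule real_dist_normal_dist)
    show ?thesis
      unfolding centred_normal_def True using N.prob_space by (subst integral_distr) auto
  qed
  ultimately show ?thesis by (simp add: prob_space)
next
  case False
  with v_nonneg have "v > 0" by simp
  define \<sigma> where "\<sigma> = sqrt v"
  have \<sigma>: "\<sigma> > 0" "v = \<sigma>\<^sup>2" using \<open>v > 0\<close> by (auto simp: \<sigma>_def)
  interpret N: real_distribution std_normal_distribution by (rule real_dist_normal_dist)
  \<comment> \<open>These sums are standardised; the test function
    \<open>cos (\<sigma> * x + c)\<close> puts the scale back.\<close>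
  let ?S = "\<lambda>n \<omega>. (\<Sum>i<n. \<xi> i \<omega> - m) / sqrt (n * \<sigma>\<^sup>2)"
  have rd: "real_distribution (distr M borel (?S n))" for n
    by (intro real_distribution_distr) measurable
  have "weak_conv_m (\<lambda>n. distr M borel (?S n)) std_normal_distribution"
    using central_limit_theorem[OF indep mean \<sigma>(1) sq_int _ distr] var \<sigma>(2) mean by simp
  then have "(\<lambda>n. \<integral>x. cos (\<sigma> * x + c) \<partial>distr M borel (?S n)) \<longlonglongrightarrow> (\<integral>x. cos (\<sigma> * x + c) \<partial>std_normal_distribution)"
    using rd N.real_distribution_axioms
    by (intro weak_conv_imp_integral_bdd_continuous_conv[where B=1]) (auto intro!: continuous_intros)
  moreover have "(\<integral>x. cos (\<sigma> * x + c) \<partial>distr M borel (?S n)) = expectation (\<lambda>\<omega>. cos (normalised_sum n \<omega> + c))" for n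
    using \<sigma> by (subst integral_distr) (auto simp: normalised_sum_def real_sqrt_mult)
  moreover have "(\<integral>x. cos (\<sigma> * x + c) \<partial>std_normal_distribution) = (\<integral>x. cos (x + c) \<partial>centred_normal v)"
    unfolding centred_normal_def \<sigma>_def by (subst integral_distr) auto
  ultimately show ?thesis by simp
qed

end

section \<open>Bounded continuous kernels\<close>

locale bounded_continuous_rkhs =
  fixes k :: "'x::topological_space \<Rightarrow> 'x \<Rightarrow> real"
    and val :: "'h::{real_inner,banach} \<Rightarrow> 'x \<Rightarrow> real"
    and B :: real
  assumes rkhs: "is_rkhs k val"
    and cont: "continuous_on UNIV (\<lambda>(x, y). k x y)"
    and bound: "\<bar>k x y\<bar> \<le> B"
begin

abbreviation feature :: "'x \<Rightarrow> 'h" where "feature \<equiv> kernel_section k val"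

lemma inner_feature: "inner f (feature x) = val f x"
  using is_rkhs_section(2)[OF rkhs] .

lemma inner_feature_feature: "inner (feature x) (feature y) = k y x"
  using is_rkhs_section(1)[OF rkhs, of x] by (simp add: inner_feature)

lemma kernel_sym: "k x y = k y x"
  by (metis inner_commute inner_feature_feature)

lemma norm_feature_sq: "(norm (feature x))\<^sup>2 = k x x"
  by (simp add: power2_norm_eq_inner inner_feature_feature)

lemma norm_feature_le: "norm (feature x) \<le> sqrt B"
proof (rule real_le_rsqrt)
  show "(norm (feature x))\<^sup>2 \<le> B"
    using bound[of x x] by (simp add: norm_feature_sq)
qed

lemma B_nonneg: "B \<ge> 0"
  using bound[of undefined undefined] by linarith

text \<open>The squared distance of two features is k x x - 2 k x x0 + k x0 x0, which is continuous
  in x and vanishes at x0.\<close>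

lemma feature_continuous: "continuous_on UNIV feature"
  unfolding continuous_on_def
proof
  fix x0
  have diag: "continuous_on UNIV (\<lambda>x. k (g x) (h x))" if "continuous_on UNIV g" "continuous_on UNIV h"
    for g h :: "'x \<Rightarrow> 'x"
    using continuous_on_compose2[OF cont, of UNIV "\<lambda>x. (g x, h x)"] that
    by (auto intro: continuous_on_Pair)
  have eq: "norm (feature x - feature x0) = sqrt (k x x - 2 * k x x0 + k x0 x0)" for x
    by (simp add: norm_eq_sqrt_inner inner_diff_left inner_diff_right inner_feature_feature kernel_sym[of x0 x])
  have "continuous_on UNIV (\<lambda>x. norm (feature x - feature x0))"
    unfolding eq by (intro continuous_intros diag)
  then have "((\<lambda>x. norm (feature x - feature x0)) \<longlongrightarrow> norm (feature x0 - feature x0)) (at x0 within UNIV)"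
    unfolding continuous_on_def by blast
  then have "((\<lambda>x. feature x - feature x0) \<longlongrightarrow> 0) (at x0 within UNIV)"
    by (simp add: tendsto_norm_zero_iff)
  then show "(feature \<longlongrightarrow> feature x0) (at x0 within UNIV)"
    by (rule LIM_zero_cancel)
qed

lemma val_continuous: "continuous_on UNIV (val f)"
  using continuous_on_inner[OF continuous_on_const feature_continuous, of f] by (simp add: inner_feature)

lemma val_measurable: "val f \<in> borel_measurable borel"
  by (intro borel_measurable_continuous_onI val_continuous)

lemma feature_measurable: "feature \<in> borel_measurable borel"
  by (intro borel_measurable_continuous_onI feature_continuous)

lemma abs_val_le: "\<bar>val f x\<bar> \<le> norm f * sqrt B"
proof -
  have "\<bar>val f x\<bar> \<le> norm f * norm (feature x)"
    using Cauchy_Schwarz_ineq2[of f "feature x"] by (simp add: inner_feature)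
  also have "\<dots> \<le> norm f * sqrt B" by (intro mult_left_mono norm_feature_le) simp
  finally show ?thesis .
qed

lemma val_add: "val (f + g) x = val f x + val g x"
  by (simp add: inner_feature[symmetric] inner_add_left)

lemma val_scale: "val (c *\<^sub>R f) x = c * val f x"
  by (simp add: inner_feature[symmetric])

lemma val_eq_0: "(\<And>x. val f x = 0) \<Longrightarrow> f = 0"
  using rkhs inj_eq[of val f 0] by (auto simp: is_rkhs_def inner_feature[of 0, symmetric])

text \<open>A vector orthogonal to all \<open>e i\<close> is orthogonal to the features at the dense
  points, so its function vanishes on a dense set and, by continuity, everywhere.\<close>

lemma exists_hilbert_basis:
  assumes "separable_space (euclidean :: 'x topology)"
  shows "\<exists>e :: nat \<Rightarrow> 'h. hilbert_basis e"
proof -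
  obtain D :: "'x set" where D: "countable D" "closure D = UNIV"
    using assms by (auto simp: separable_space_def)
  \<comment> \<open>Nonemptiness is what makes \<open>from_nat_into\<close> enumerate exactly the
    points of D.\<close>
  then have "D \<noteq> {}" by auto
  define d where "d n = feature (from_nat_into D n)" for n
  define e where "e = inner_form.gram_schmidt d"
  have "hilbert_basis e"
  proof
    show "inner (e i) (e j) = 0" if "i \<noteq> j" for i j
      using that by (simp add: e_def inner_form.gram_schmidt_orthogonal)
    show "inner (e i) (e i) \<in> {0, 1}" for i
      unfolding e_def by (rule inner_form.gram_schmidt_self)
    show "f = 0" if f: "\<And>i. inner f (e i) = 0" for f
    proof (rule val_eq_0)
      fix x
      have "inner (d n) f = 0" for n
        using inner_form.gram_schmidt_expand[of n "Suc n" d f] f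
        by (simp add: e_def inner_commute[of _ f])
      then have "val f (from_nat_into D n) = 0" for n
        by (simp add: d_def inner_feature[symmetric] inner_commute[of f])
      then have "D \<subseteq> {x. val f x = 0}"
        using subset_range_from_nat_into[OF D(1)] by auto
      moreover have "closed {x. val f x = 0}"
        by (intro closed_Collect_eq val_continuous continuous_on_const)
      ultimately have "closure D \<subseteq> {x. val f x = 0}" by (rule closure_minimal)
      with D(2) show "val f x = 0" by auto
    qed
  qed
  then show ?thesis by blast
qed

end

section \<open>The covariance form of the kernel and the limit theorem\<close>

locale rkhs_probability = bounded_continuous_rkhs k val B + hilbert_basis e + P: prob_space P
  for k :: "'x::topological_space \<Rightarrow> 'x \<Rightarrow> real"
    and val :: "'h::{real_inner,banach} \<Rightarrow> 'x \<Rightarrow> real" and B and e :: "nat \<Rightarrow> 'h"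
    and P :: "'x measure" +
  assumes sets_P: "sets P = sets borel"
begin

lemma mean_embedding_inner:
  assumes "prob_space Q" "sets Q = sets borel"
  shows "inner (mean_embedding k val Q) g = (\<integral>x. val g x \<partial>Q)"
proof -
  interpret Q: prob_space Q by fact
  have m: "feature \<in> borel_measurable Q"
    using feature_measurable measurable_cong_sets[OF assms(2) refl] by blast
  have "(\<integral>\<^sup>+x. norm (feature x) \<partial>Q) \<le> (\<integral>\<^sup>+x. ennreal (sqrt B) \<partial>Q)"
    by (intro nn_integral_mono ennreal_leI norm_feature_le)
  also have "\<dots> < \<infinity>" by (simp add: Q.emeasure_space_1)
  finally show ?thesis
    unfolding mean_embedding_def
    using bochner_int_inner(2)[OF Q.finite_measure_axioms m]
    by (simp add: inner_feature inner_commute[of "feature _"])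
qed

text \<open>For n = 0 the empirical measure is not a probability measure; in the process that case
  is absorbed by the factor \<open>sqrt 0\<close>.\<close>

lemma mean_embedding_empirical_inner:
  assumes "n > 0"
  shows "inner (mean_embedding k val (empirical_measure x n)) g = (\<Sum>i<n. val g (x i)) / n"
proof -
  have u: "prob_space (uniform_count_measure {..<n})"
    using assms by (intro prob_space_uniform_count_measure) auto
  have m: "x \<in> measurable (uniform_count_measure {..<n}) borel"
    by (simp add: measurable_def space_uniform_count_measure sets_uniform_count_measure)
  have "inner (mean_embedding k val (empirical_measure x n)) g = (\<integral>y. val g y \<partial>empirical_measure x n)"
    unfolding empirical_measure_def
    by (intro mean_embedding_inner prob_space.prob_space_distr[OF u m]) simp
  also have "\<dots> = (\<integral>i. val g (x i) \<partial>uniform_count_measure {..<n})"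
    unfolding empirical_measure_def using m val_measurable by (intro integral_distr)
  also have "\<dots> = (\<Sum>i<n. val g (x i)) / n"
    by (subst integral_uniform_count_measure) auto
  finally show ?thesis .
qed

lemma val_P_measurable [measurable]: "val f \<in> borel_measurable P"
  using val_measurable measurable_cong_sets[OF sets_P refl] by blast

lemma val_P_integrable: "integrable P (val f)"
  using abs_val_le by (intro P.integrable_const_bound[where B="norm f * sqrt B"]) auto

lemma val_mult_P_integrable: "integrable P (\<lambda>x. val f x * val g x)"
proof (rule P.integrable_const_bound)
  show "AE x in P. norm (val f x * val g x) \<le> (norm f * sqrt B) * (norm g * sqrt B)"
    unfolding norm_mult by (intro AE_I2 mult_mono) (auto simp: abs_val_le B_nonneg)
qed measurable

definition cov_form :: "'h \<Rightarrow> 'h \<Rightarrow> real" where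
  "cov_form f g = (\<integral>x. val f x * val g x \<partial>P) - (\<integral>x. val f x \<partial>P) * (\<integral>x. val g x \<partial>P)"

lemma cov_form_self: "cov_form f f = P.variance (val f)"
  using val_mult_P_integrable[of f f]
  by (subst P.variance_eq) (auto simp: cov_form_def val_P_integrable power2_eq_square)

lemma cov_form_self_le: "cov_form f f \<le> (\<integral>x. (val f x)\<^sup>2 \<partial>P)"
  by (simp add: cov_form_def power2_eq_square)

text \<open>Boundedness follows from the reproducing property, which bounds the values of f by
  \<open>norm f * sqrt B\<close>. For the trace, Bessel applied to \<open>feature x\<close> bounds
  the partial sums of squares by k x x pointwise, and integration keeps the bound B.\<close>

sublocale trace_class_form e cov_form B
proof
  fix f g h :: 'h and c :: real
  show "cov_form f g = cov_form g f" by (simp add: cov_form_def mult.commute)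
  show "cov_form (f + g) h = cov_form f h + cov_form g h"
    by (simp add: cov_form_def val_add distrib_right val_P_integrable val_mult_P_integrable)
  show "cov_form (c *\<^sub>R f) g = c * cov_form f g"
    by (simp add: cov_form_def val_scale mult.assoc right_diff_distrib)
  show "0 \<le> cov_form f f"
    unfolding cov_form_self by (rule P.variance_positive)
  have "(val f x)\<^sup>2 \<le> B * (norm f)\<^sup>2" for x
  proof -
    have "\<bar>val f x\<bar>\<^sup>2 \<le> (norm f * sqrt B)\<^sup>2"
      by (intro power_mono abs_val_le) simp
    then show ?thesis using B_nonneg by (simp add: power_mult_distrib mult.commute)
  qed
  then have "(\<integral>x. (val f x)\<^sup>2 \<partial>P) \<le> (\<integral>x. B * (norm f)\<^sup>2 \<partial>P)"
    using val_mult_P_integrable[of f f] by (intro integral_mono) (auto simp: power2_eq_square)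
  then show "cov_form f f \<le> B * (norm f)\<^sup>2"
    using cov_form_self_le[of f] by (simp add: P.prob_space)
  show "summable (\<lambda>i. cov_form (e i) (e i))"
  proof (rule summableI_nonneg_bounded[where x=B])
    show "0 \<le> cov_form (e i) (e i)" for i
      unfolding cov_form_self by (rule P.variance_positive)
    fix n
    have "(\<Sum>i<n. cov_form (e i) (e i)) \<le> (\<Sum>i<n. \<integral>x. (val (e i) x)\<^sup>2 \<partial>P)"
      by (intro sum_mono cov_form_self_le)
    also have "\<dots> = (\<integral>x. (\<Sum>i<n. (val (e i) x)\<^sup>2) \<partial>P)"
      using val_mult_P_integrable by (subst Bochner_Integration.integral_sum) (auto simp: power2_eq_square)
    also have "\<dots> \<le> (\<integral>x. B \<partial>P)"
    proof (intro integral_mono)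
      show "integrable P (\<lambda>x. \<Sum>i<n. (val (e i) x)\<^sup>2)"
        using val_mult_P_integrable by (intro Bochner_Integration.integrable_sum) (simp add: power2_eq_square)
      show "(\<Sum>i<n. (val (e i) x)\<^sup>2) \<le> B" for x
        using Bessel[where x="feature x" and m=n] bound[of x x]
        by (simp add: norm_feature_sq inner_feature[symmetric] inner_commute[of "feature x"])
    qed simp
    finally show "(\<Sum>i<n. cov_form (e i) (e i)) \<le> B" by (simp add: P.prob_space)
  qed
qed

text \<open>Pairing with g turns the process into the normalised sum of the real variables
  \<open>val g (X i \<omega>)\<close>, so measurability, second moments and the cosine limit are all
  one-dimensional facts.\<close>

lemma empirical_process_converges:
  fixes M :: "'w measure" and X :: "nat \<Rightarrow> 'w \<Rightarrow> 'x"
  assumes M: "prob_space M" and indep: "prob_space.indep_vars M (\<lambda>_. borel) X UNIV"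
    and distr: "\<And>i. distr M borel (X i) = P"
  shows "converges_in_distribution M
    (\<lambda>n \<omega>. sqrt n *\<^sub>R (mean_embedding k val (empirical_measure (\<lambda>i. X i \<omega>) n) - mean_embedding k val P))
    gaussian_measure (\<lambda>z. z)"
    (is "converges_in_distribution M ?Y _ _")
proof -
  interpret M: prob_space M by fact
  have X [measurable]: "X i \<in> measurable M borel" for i
    using indep by (auto simp: M.indep_vars_def)
  have iid: "iid_square_integrable M (\<lambda>i \<omega>. val g (X i \<omega>)) (distr P borel (val g)) (\<integral>x. val g x \<partial>P) (cov_form g g)" for g
  proof -
    note [measurable] = val_measurable[of g]
    have E: "(\<integral>\<omega>. h (X i \<omega>) \<partial>M) = (\<integral>x. h x \<partial>P)" if "h \<in> borel_measurable borel" for h :: "'x \<Rightarrow> real" and i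
      unfolding distr[of i, symmetric] using that by (subst integral_distr) auto
    show ?thesis
    proof
      show "M.indep_vars (\<lambda>_. borel) (\<lambda>i \<omega>. val g (X i \<omega>)) UNIV"
        using M.indep_vars_compose2[OF indep, of "\<lambda>_. val g" "\<lambda>_. borel"] val_measurable by simp
      show "distr M borel (\<lambda>\<omega>. val g (X i \<omega>)) = distr P borel (val g)" for i
        unfolding distr[of i, symmetric] by (subst distr_distr) (auto simp: comp_def)
      show "integrable M (\<lambda>\<omega>. (val g (X i \<omega>))\<^sup>2)" for i
      proof -
        have "integrable (distr M borel (X i)) (\<lambda>x. (val g x)\<^sup>2)"
          unfolding distr using val_mult_P_integrable[of g g] by (simp add: power2_eq_square)
        then show ?thesis by (subst (asm) integrable_distr_eq) auto
      qed
      show mean: "M.expectation (\<lambda>\<omega>. val g (X i \<omega>)) = (\<integral>x. val g x \<partial>P)" for i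
        by (rule E[OF val_measurable])
      show "M.variance (\<lambda>\<omega>. val g (X i \<omega>)) = cov_form g g" for i
        unfolding mean cov_form_self by (rule E) measurable
    qed
  qed
  have inner_Y: "inner (?Y n \<omega>) g
      = iid_square_integrable.normalised_sum (\<lambda>i \<omega>. val g (X i \<omega>)) (\<integral>x. val g x \<partial>P) n \<omega>" for n \<omega> g
  proof (cases "n = 0")
    case True
    then show ?thesis by (simp add: iid_square_integrable.normalised_sum_def[OF iid])
  next
    case False
    then have "inner (?Y n \<omega>) g = sqrt n * ((\<Sum>i<n. val g (X i \<omega>)) / n - (\<integral>x. val g x \<partial>P))"
      by (simp add: inner_diff_left mean_embedding_empirical_inner mean_embedding_inner[OF P.prob_space_axioms sets_P])
    also have "\<dots> = ((\<Sum>i<n. val g (X i \<omega>)) - n * (\<integral>x. val g x \<partial>P)) / sqrt n"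
    proof -
      \<comment> \<open>With n written as s * s the claim becomes an identity of rational
        expressions in s.\<close>
      define s where "s = sqrt n"
      have s: "s > 0" "real n = s * s" using False by (simp_all add: s_def)
      show ?thesis
        unfolding s_def[symmetric] s(2) using s(1) by (simp add: field_simps)
    qed
    finally show ?thesis
      by (simp add: iid_square_integrable.normalised_sum_def[OF iid] sum_subtractf)
  qed
  show ?thesis
  proof (rule converges_in_distributionI[where c="\<lambda>i. cov_form (e i) (e i)"])
    show "?Y n \<in> borel_measurable M" for n
      by (rule borel_measurable_coeffI)
         (simp only: inner_Y iid_square_integrable.normalised_sum_measurable[OF iid])
    show "(\<integral>\<^sup>+\<omega>. ennreal ((inner (?Y n \<omega>) (e i))\<^sup>2) \<partial>M) \<le> ennreal (cov_form (e i) (e i))" for n i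
      unfolding inner_Y by (rule iid_square_integrable.normalised_sum_second_moment[OF iid])
    show "(\<lambda>n. \<integral>\<omega>. cos (inner (?Y n \<omega>) t + b) \<partial>M) \<longlonglongrightarrow> (\<integral>z. cos (inner z t + b) \<partial>gaussian_measure)" for t b
    proof -
      have "(\<integral>z. cos (inner z t + b) \<partial>gaussian_measure) = (\<integral>x. cos (x + b) \<partial>centred_normal (cov_form t t))"
        unfolding distr_gaussian_measure[symmetric] by (subst integral_distr) auto
      then show ?thesis
        unfolding inner_Y using iid_square_integrable.normalised_sum_cos_tendsto[OF iid] by simp
    qed
  qed (auto simp: M prob_space_gaussian_measure id_measurable_gaussian_measure summable_diag nonneg
      gaussian_measure_second_moment)
qed

end

theorem theorem9:
  fixes k :: "'x::topological_space \<Rightarrow> 'x \<Rightarrow> real"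
    and val :: "'h::{real_inner,banach} \<Rightarrow> 'x \<Rightarrow> real"
    and P :: "'x measure"
    and M :: "'w measure"
    and X :: "nat \<Rightarrow> 'w \<Rightarrow> 'x"
  assumes "separable_space (euclidean :: 'x topology)"
    and "is_kernel k"
    and "bounded (range (\<lambda>(x, y). k x y))"
    and "continuous_on UNIV (\<lambda>(x, y). k x y)"
    and "is_rkhs k val"
    and "prob_space P" and "sets P = sets borel"
    and "prob_space M"
    and "prob_space.indep_vars M (\<lambda>_. borel) X UNIV"
    and "\<And>i. distr M borel (X i) = P"
  shows "\<exists>(C :: 'h \<Rightarrow> 'h) (N :: 'h measure) (Z :: 'h \<Rightarrow> 'h).
           C \<in> L1_plus \<and>
           (\<forall>f g. inner (C f) g
              = (\<integral>x. val f x * val g x \<partial>P) - (\<integral>x. val f x \<partial>P) * (\<integral>x. val g x \<partial>P)) \<and>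
           gaussian_element N Z \<and> has_mean_zero N Z \<and> has_covariance_operator N Z C \<and>
           converges_in_distribution M
             (\<lambda>n \<omega>. sqrt (real n) *\<^sub>R
                (mean_embedding k val (empirical_measure (\<lambda>i. X i \<omega>) n) - mean_embedding k val P))
             N Z"
proof -
  obtain B where "\<And>x y. \<bar>k x y\<bar> \<le> B"
    using assms(3) by (auto simp: bounded_iff)
  then interpret bounded_continuous_rkhs k val B
    using assms(4,5) by (intro bounded_continuous_rkhs.intro)
  obtain e :: "nat \<Rightarrow> 'h" where "hilbert_basis e"
    using exists_hilbert_basis[OF assms(1)] by blast
  then interpret rkhs_probability k val B e P
    using assms by (intro rkhs_probability.intro rkhs_probability_axioms.intro bounded_continuous_rkhs_axioms)
  show ?thesis
    using form_operator_L1_plus gaussian_element_gaussian_measure has_mean_zero_gaussian_measure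
      has_covariance_operator_gaussian_measure empirical_process_converges[OF assms(8-10)]
    by (intro exI[of _ form_operator] exI[of _ gaussian_measure] exI[of _ "\<lambda>z. z"])
       (simp add: inner_form_operator cov_form_def)
qed

end
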